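(* Fix a constant $L>0$. There exist positive constants $C_1$ and $C_2$ (depending on $L$) such that the following holds. For all partitions $\lambda\vdash n$ and $\mu\vdash k$ such that $\lambda$ has fewer than $L\sqrt{n}$ rows and fewer than $L\sqrt{n}$ columns, $\mu$ has fewer than $L\sqrt{k}$ rows and fewer than $L\sqrt{k}$ columns, and $k<C_1n^{1/2}$, we have $$A_{\lambda/\mu}\le e^{C_2k^{3/2}n^{-1/2}}.$$
   Context: For a partition $\nu$, $f^\nu$ denotes the number of standard Young tableaux of shape $\nu$; for $\mu\subseteq\lambda$, $f^{\lambda/\mu}$ denotes the number of standard Young tableaux of skew shape $\lambda/\mu$. $A_{\lambda/\mu}:=|\mu|!\,\frac{f^{\lambda/\mu}}{f^\lambda f^\mu}$. *)

theory Defs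
  imports "HOL-Analysis.Analysis"
begin

definition is_partition :: "nat list \<Rightarrow> bool" where
  "is_partition la \<longleftrightarrow> sorted_wrt (\<ge>) la \<and> (\<forall>x\<in>set la. 0 < x)"

definition partition_of :: "nat list \<Rightarrow> nat \<Rightarrow> bool" where
  "partition_of la n \<longleftrightarrow> is_partition la \<and> sum_list la = n"

definition num_rows :: "nat list \<Rightarrow> nat" where
  "num_rows la = length la"

definition num_cols :: "nat list \<Rightarrow> nat" where
  "num_cols la = (if la = [] then 0 else hd la)"

text \<open>Young diagram (English convention, 0-indexed cells (row, column)).\<close>
definition young_diagram :: "nat list \<Rightarrow> (nat \<times> nat) set" where
  "young_diagram la = {(i, j). i < length la \<and> j < la ! i}"

definition part_subseteq :: "nat list \<Rightarrow> nat list \<Rightarrow> bool" where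
  "part_subseteq mu la \<longleftrightarrow> young_diagram mu \<subseteq> young_diagram la"

definition skew_diagram :: "nat list \<Rightarrow> nat list \<Rightarrow> (nat \<times> nat) set" where
  "skew_diagram la mu = young_diagram la - young_diagram mu"

text \<open>Standard Young tableaux of a shape given by a finite cell set D: bijective fillings
  of D with 1..|D|, strictly increasing along rows and down columns; the functions are
  taken to be 0 off D so that distinct tableaux are distinct functions.\<close>
definition SYT :: "(nat \<times> nat) set \<Rightarrow> (nat \<times> nat \<Rightarrow> nat) set" where
  "SYT D = {T. bij_betw T D {1..card D} \<and> (\<forall>c. c \<notin> D \<longrightarrow> T c = 0)
      \<and> (\<forall>i j. (i, j) \<in> D \<and> (i, Suc j) \<in> D \<longrightarrow> T (i, j) < T (i, Suc j))
      \<and> (\<forall>i j. (i, j) \<in> D \<and> (Suc i, j) \<in> D \<longrightarrow> T (i, j) < T (Suc i, j))}"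

definition f_skew :: "nat list \<Rightarrow> nat list \<Rightarrow> nat" where
  "f_skew la mu = card (SYT (skew_diagram la mu))"

definition f_shape :: "nat list \<Rightarrow> nat" where
  "f_shape la = card (SYT (young_diagram la))"

definition A_skew :: "nat list \<Rightarrow> nat list \<Rightarrow> real" where
  "A_skew la mu = fact (sum_list mu) * real (f_skew la mu) / (real (f_shape la) * real (f_shape mu))"

end

theory Submission
  imports Defs
begin

text \<open>
  Iterating the branching rule of shifted Schur functions gives the Okounkov--Olshanski formula
  \<open>f(\<lambda>/\<mu>) n! = s*\<^sub>\<mu>(\<lambda>) f\<^sup>\<lambda> (n - k)!\<close>: both sides satisfy the same recursion in \<open>\<mu>\<close>, and
  \<open>s*\<^sub>\<mu>(\<lambda>)\<close> vanishes unless \<open>\<mu> \<subseteq> \<lambda>\<close>. All its terms are nonnegative, so it is at most the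
  ordinary Schur function at \<open>\<lambda>\<^sub>i + L \<surd>k\<close>, which costs a factor \<open>exp (O(k powr (3/2) * n powr (-1/2)))\<close>.

  It remains to compare \<open>k! s\<^sub>\<mu>(x) / f\<^sup>\<mu>\<close> with \<open>(\<Sum> x\<^sub>i)\<^sup>k\<close>. In the expansion by contents \<open>\<alpha>\<close>, the
  letters that occur once contribute exactly as much as in the Plancherel case; since removing one
  cell commutes with removing horizontal strips, the repeated letters can be removed first. Removing
  a \<open>j\<close>-strip from a shape with \<open>m\<close> cells and at most \<open>R\<close> columns costs
  \<open>\<Prod>\<^sub>r\<^sub><\<^sub>j (m + r R) / (m - r)\<close>, by the same formula applied to a one-row \<open>\<mu>\<close>. While \<open>m \<ge> k/2\<close> this
  is close to 1, and contents in which more than half of the letters are repeated are rare.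
\<close>

section \<open>Partitions as functions and horizontal strips\<close>

text \<open>The obstacle is the exponent \<open>3/2\<close>. Bounding every Kostka number by
  \<open>f\<^sup>\<mu>\<close> gives \<open>X^k * exp (k * \<epsilon>)\<close>, where
  \<open>X\<close> is the sum of the variables, \<open>M\<close> bounds each of them and
  \<open>\<epsilon> = M * k / X\<close>. Here \<open>M\<close> has order \<open>sqrt n\<close> and
  \<open>X\<close> has order \<open>n\<close>, so the exponent is of order
  \<open>k^2 / sqrt n\<close>, too large by a factor \<open>sqrt k\<close>. The excess is due to
  repeated letters, for which the proportion \<open>1\<close> is wasteful: a \<open>j\<close>-strip
  taken from a shape with about \<open>k\<close> cells and at most \<open>R\<close> columns has
  proportion about \<open>1/j!\<close>, up to factors \<open>1 + r * \<rho>\<close> with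
  \<open>\<rho>\<close> of order \<open>R / k\<close>. In the estimate by rising factorials this
  shrinks the step from \<open>M\<close> to \<open>\<rho> * M\<close>, and the exponent from
  \<open>k * \<epsilon>\<close> to \<open>2 * (R + 1) * \<epsilon>\<close>, where \<open>R\<close>
  has order \<open>sqrt k\<close>. The gain is available only while a fixed share of the
  \<open>k\<close> cells is still present. The remaining contents are bounded trivially, and their
  total is of order \<open>\<epsilon>\<close> once \<open>\<epsilon>\<close> lies below an absolute
  constant; this is the main use of \<open>k < C1 * sqrt n\<close>.\<close>

definition par :: "(nat \<Rightarrow> nat) \<Rightarrow> bool" where
  "par p \<longleftrightarrow> (\<forall>i. p (Suc i) \<le> p i) \<and> (\<exists>N. \<forall>i\<ge>N. p i = 0)"

definition psize :: "(nat \<Rightarrow> nat) \<Rightarrow> nat" where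
  "psize p = (\<Sum>i | p i \<noteq> 0. p i)"

definition inc :: "(nat \<Rightarrow> nat) \<Rightarrow> nat \<Rightarrow> nat \<Rightarrow> nat" where
  "inc p i = p(i := Suc (p i))"

definition dec :: "(nat \<Rightarrow> nat) \<Rightarrow> nat \<Rightarrow> nat \<Rightarrow> nat" where
  "dec p i = p(i := p i - 1)"

definition addable :: "(nat \<Rightarrow> nat) \<Rightarrow> nat set" where
  "addable p = {i. i = 0 \<or> p i < p (i - 1)}"

definition removable :: "(nat \<Rightarrow> nat) \<Rightarrow> nat set" where
  "removable p = {i. p (Suc i) < p i}"

text \<open>The inner shapes \<open>q\<close> for which \<open>p / q\<close> is a horizontal strip,
  of any size: interlacing says that no column contains two cells of \<open>p / q\<close>.\<close>

definition hstrips :: "(nat \<Rightarrow> nat) \<Rightarrow> (nat \<Rightarrow> nat) set" where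
  "hstrips p = {q. \<forall>i. q i \<le> p i \<and> p (Suc i) \<le> q i}"

definition cells :: "(nat \<Rightarrow> nat) \<Rightarrow> (nat \<Rightarrow> nat) \<Rightarrow> (nat \<times> nat) set" where
  "cells p q = {(i, j). q i \<le> j \<and> j < p i}"

lemma psize_eq:
  assumes "\<And>i. i \<ge> N \<Longrightarrow> p i = 0" shows "psize p = (\<Sum>i<N. p i)"
proof -
  have "{i. p i \<noteq> 0} \<subseteq> {..<N}" using assms by (metis (mono_tags) leI lessThan_iff mem_Collect_eq subsetI)
  then show ?thesis unfolding psize_def by (intro sum.mono_neutral_left) auto
qed

lemma par_mono: "par p \<Longrightarrow> i \<le> j \<Longrightarrow> p j \<le> p i"
  unfolding par_def by (meson lift_Suc_antimono_le)

lemma par_zero [simp]: "par (\<lambda>_. 0)"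
  by (simp add: par_def)

lemma psize_zero [simp]: "psize (\<lambda>_. 0) = 0"
  by (simp add: psize_def)

lemma psize_eq_0: "par p \<Longrightarrow> psize p = 0 \<longleftrightarrow> p = (\<lambda>_. 0)"
proof
  assume p: "par p" "psize p = 0"
  obtain N where N: "\<And>i. i \<ge> N \<Longrightarrow> p i = 0" using p(1) unfolding par_def by blast
  have "(\<Sum>i<N. p i) = 0" using p(2) psize_eq[of N p] N by simp
  then have "\<And>i. i < N \<Longrightarrow> p i = 0" by simp
  with N show "p = (\<lambda>_. 0)" by (metis not_less ext)
qed simp

lemma psize_le_eq:
  assumes "par p" "\<And>i. q i \<le> p i" "psize q = psize p"
  shows "q = p"
proof (rule ext)
  fix i
  obtain N where N: "\<And>i. i \<ge> N \<Longrightarrow> p i = 0" using assms(1) unfolding par_def by blast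
  have Nq: "\<And>i. i \<ge> N \<Longrightarrow> q i = 0" using N assms(2) by (metis le_zero_eq)
  have "(\<Sum>i<N. p i - q i) = (\<Sum>i<N. p i) - (\<Sum>i<N. q i)"
    by (rule sum_subtractf_nat) (use assms in auto)
  also have "\<dots> = 0" using assms(3) psize_eq[of N p, OF N] psize_eq[of N q, OF Nq] by simp
  finally have "\<And>i. i < N \<Longrightarrow> p i - q i = 0" by simp
  then show "q i = p i" using N Nq assms(2) by (metis diff_is_0_eq le_antisym not_less)
qed

lemma psize_mono:
  assumes "par p" "\<And>i. q i \<le> p i" shows "psize q \<le> psize p"
proof -
  obtain N where N: "\<And>i. i \<ge> N \<Longrightarrow> p i = 0" using assms(1) unfolding par_def by blast
  have Nq: "\<And>i. i \<ge> N \<Longrightarrow> q i = 0" using N assms(2) by (metis le_zero_eq)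
  show ?thesis using psize_eq[of N p, OF N] psize_eq[of N q, OF Nq] assms(2) by (simp add: sum_mono)
qed

lemma psize_inc:
  assumes "par p" shows "psize (inc p i) = Suc (psize p)"
proof -
  obtain N where N: "\<And>i. i \<ge> N \<Longrightarrow> p i = 0" using assms(1) unfolding par_def by blast
  let ?N = "max N (Suc i)"
  have "psize (inc p i) = (\<Sum>l<?N. inc p i l)"
    by (rule psize_eq) (use N in \<open>auto simp: inc_def\<close>)
  also have "\<dots> = (\<Sum>l<?N. p l + (if l = i then 1 else 0))"
    by (rule sum.cong) (auto simp: inc_def)
  also have "\<dots> = Suc (\<Sum>l<?N. p l)" by (simp add: sum.distrib)
  also have "(\<Sum>l<?N. p l) = psize p" by (rule psize_eq[symmetric]) (use N in auto)
  finally show ?thesis .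
qed

lemma inc_dec: "p i > 0 \<Longrightarrow> inc (dec p i) i = p"
  by (auto simp: inc_def dec_def)

lemma dec_inc: "dec (inc p i) i = p"
  by (auto simp: inc_def dec_def)

lemma par_inc:
  assumes "par p" "i \<in> addable p" shows "par (inc p i)"
proof -
  obtain N where N: "\<And>i. i \<ge> N \<Longrightarrow> p i = 0" using assms(1) unfolding par_def by blast
  have "\<forall>l\<ge>max N (Suc i). inc p i l = 0" using N by (auto simp: inc_def)
  moreover have "inc p i (Suc l) \<le> inc p i l" for l
    using assms par_mono[of p l "Suc l"] by (auto simp: inc_def addable_def)
  ultimately show ?thesis unfolding par_def by blast
qed

lemma par_dec:
  assumes "par p" "i \<in> removable p" shows "par (dec p i)"
proof -
  obtain N where N: "\<And>i. i \<ge> N \<Longrightarrow> p i = 0" using assms(1) unfolding par_def by blast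
  have "\<forall>l\<ge>N. dec p i l = 0" using N by (auto simp: dec_def)
  moreover have "dec p i (Suc l) \<le> dec p i l" for l
    using assms par_mono[of p l "Suc l"] by (auto simp: dec_def removable_def)
  ultimately show ?thesis unfolding par_def by blast
qed

lemma psize_dec:
  assumes "par p" "i \<in> removable p" shows "psize p = Suc (psize (dec p i))"
  using psize_inc[OF par_dec[OF assms], of i] inc_dec[of p i] assms(2)
  by (simp add: removable_def)

lemma finite_addable: assumes "par p" shows "finite (addable p)"
proof -
  obtain N where N: "\<And>i. i \<ge> N \<Longrightarrow> p i = 0" using assms(1) unfolding par_def by blast
  have "addable p \<subseteq> {..N}"
  proof
    fix i assume "i \<in> addable p"
    then have "i = 0 \<or> i - 1 < N" using N[of "i - 1"] by (auto simp: addable_def not_less[symmetric])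
    then show "i \<in> {..N}" by auto
  qed
  then show ?thesis by (rule finite_subset) simp
qed

lemma finite_removable: assumes "par p" shows "finite (removable p)"
proof -
  obtain N where N: "\<And>i. i \<ge> N \<Longrightarrow> p i = 0" using assms(1) unfolding par_def by blast
  have "removable p \<subseteq> {..N}"
  proof
    fix i assume "i \<in> removable p"
    then have "i < N" using N[of i] by (auto simp: removable_def not_less[symmetric])
    then show "i \<in> {..N}" by auto
  qed
  then show ?thesis by (rule finite_subset) simp
qed

lemma hstrips_par: assumes "par p" "q \<in> hstrips p" shows "par q"
proof -
  obtain N where N: "\<And>i. i \<ge> N \<Longrightarrow> p i = 0" using assms(1) unfolding par_def by blast
  have h: "q i \<le> p i" "p (Suc i) \<le> q i" for i using assms(2) by (simp_all add: hstrips_def)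
  have "q i = 0" if "i \<ge> N" for i using N[OF that] h(1)[of i] by simp
  moreover have "q (Suc i) \<le> q i" for i using h(1)[of "Suc i"] h(2)[of i] by simp
  ultimately show ?thesis unfolding par_def by blast
qed

lemma hstrips_le: "q \<in> hstrips p \<Longrightarrow> q i \<le> p i"
  by (simp add: hstrips_def)

lemma finite_below: assumes "par p" shows "finite {q. \<forall>i. q i \<le> p i}"
proof -
  obtain N where N: "\<And>i. i \<ge> N \<Longrightarrow> p i = 0" using assms(1) unfolding par_def by blast
  have "finite {q. \<forall>i. (i \<in> {..<N} \<longrightarrow> q i \<in> {..p 0}) \<and> (i \<notin> {..<N} \<longrightarrow> q i = (0::nat))}"
    by (rule finite_set_of_finite_funs) auto
  moreover have "{q. \<forall>i. q i \<le> p i} \<subseteq> {q. \<forall>i. (i \<in> {..<N} \<longrightarrow> q i \<in> {..p 0}) \<and> (i \<notin> {..<N} \<longrightarrow> q i = 0)}"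
  proof
    fix q assume "q \<in> {q. \<forall>i. q i \<le> p i}"
    then have q: "q i \<le> p i" for i by simp
    have "q i \<le> p 0" for i using q[of i] par_mono[OF assms, of 0 i] by simp
    moreover have "q i = 0" if "\<not> i < N" for i using that q[of i] N[of i] by simp
    ultimately show "q \<in> {q. \<forall>i. (i \<in> {..<N} \<longrightarrow> q i \<in> {..p 0}) \<and> (i \<notin> {..<N} \<longrightarrow> q i = 0)}" by simp
  qed
  ultimately show ?thesis using finite_subset by blast
qed

lemma finite_hstrips: assumes "par p" shows "finite (hstrips p)"
  by (rule finite_subset[OF _ finite_below[OF assms]]) (auto simp: hstrips_def)

lemma psize_hstrips: "par p \<Longrightarrow> q \<in> hstrips p \<Longrightarrow> psize q \<le> psize p"
  by (rule psize_mono) (auto simp: hstrips_def)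

lemma finite_cells: assumes "par p" shows "finite (cells p q)"
proof -
  obtain N where N: "\<And>i. i \<ge> N \<Longrightarrow> p i = 0" using assms(1) unfolding par_def by blast
  have "cells p q \<subseteq> {..<N} \<times> {..<p 0}"
  proof
    fix c assume "c \<in> cells p q"
    then obtain i j where c: "c = (i, j)" "j < p i" by (auto simp: cells_def)
    then have "i < N" using N[of i] by (auto simp: not_less[symmetric])
    moreover have "j < p 0" using c par_mono[OF assms, of 0 i] by simp
    ultimately show "c \<in> {..<N} \<times> {..<p 0}" using c by simp
  qed
  then show ?thesis by (rule finite_subset) simp
qed

lemma card_cells: assumes "par p" "\<And>i. q i \<le> p i" shows "card (cells p q) = psize p - psize q"
proof -
  obtain N where N: "\<And>i. i \<ge> N \<Longrightarrow> p i = 0" using assms(1) unfolding par_def by blast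
  have Nq: "\<And>i. i \<ge> N \<Longrightarrow> q i = 0" using N assms(2) by (metis le_zero_eq)
  have "cells p q = (SIGMA i:{..<N}. {q i..<p i})"
  proof (intro set_eqI iffI)
    fix c assume "c \<in> cells p q"
    then show "c \<in> (SIGMA i:{..<N}. {q i..<p i})"
      using N[of "fst c"] by (cases "fst c < N") (auto simp: cells_def)
  qed (auto simp: cells_def)
  then have "card (cells p q) = (\<Sum>i<N. p i - q i)" by simp
  also have "\<dots> = (\<Sum>i<N. p i) - (\<Sum>i<N. q i)"
    by (rule sum_subtractf_nat) (use assms in auto)
  finally show ?thesis using psize_eq[of N p, OF N] psize_eq[of N q, OF Nq] by simp
qed

section \<open>Shifted Schur functions\<close>

text \<open>Recursive form of the sum over reverse tableaux: the head variable fills the outermost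
  strip, and the cell \<open>(i, j)\<close> contributes the variable minus the content
  \<open>j - i\<close>.\<close>

primrec shifted_schur :: "real list \<Rightarrow> (nat \<Rightarrow> nat) \<Rightarrow> real" where
  "shifted_schur [] p = (if p = (\<lambda>_. 0) then 1 else 0)"
| "shifted_schur (x # xs) p =
    (\<Sum>q\<in>hstrips p. (\<Prod>(i, j)\<in>cells p q. x + real i - real j) * shifted_schur xs q)"

text \<open>The left side collects the factors of the cells that can join the strip
  \<open>p / q\<close> from outside, the right side those of the cells of \<open>q\<close> that can
  join it from inside. Row \<open>Suc j\<close> on the left is paired with row \<open>j\<close> on
  the right. The paired terms differ by \<open>q j - p (Suc j)\<close>, which is \<open>0\<close>
  for the rows left out, so the differences sum over all rows to a difference of sizes.\<close>

lemma hstrips_addable_removable: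
  assumes p: "par p" and q: "q \<in> hstrips p"
  shows "(\<Sum>i | i = 0 \<or> p i < q (i - 1). x + real i - real (p i))
       = x - (real (psize p) - real (psize q)) + (\<Sum>j | p (Suc j) < q j. x + 1 + real j - real (q j))"
proof -
  obtain N where N: "\<And>i. i \<ge> N \<Longrightarrow> p i = 0" using p unfolding par_def by blast
  have Nq: "\<And>i. i \<ge> N \<Longrightarrow> q i = 0" using N hstrips_le[OF q] by (metis le_zero_eq)
  let ?J = "{j. p (Suc j) < q j}"
  have J: "?J \<subseteq> {..<N}" 
  proof
    fix j assume "j \<in> ?J"
    then show "j \<in> {..<N}" using Nq[of j] by (cases "j < N") auto
  qed
  have fJ: "finite ?J" by (rule finite_subset[OF J]) simp
  have S: "{i. i = 0 \<or> p i < q (i - 1)} = insert 0 (Suc ` ?J)"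
  proof (intro set_eqI iffI)
    fix i assume "i \<in> {i. i = 0 \<or> p i < q (i - 1)}"
    then show "i \<in> insert 0 (Suc ` ?J)" by (cases i) auto
  qed auto
  have "(\<Sum>j\<in>?J. real (q j) - real (p (Suc j))) = (\<Sum>j<N. real (q j) - real (p (Suc j)))"
    by (rule sum.mono_neutral_left) (use J q in \<open>auto simp: hstrips_def not_less le_antisym\<close>)
  also have "\<dots> = real (psize q) - (\<Sum>j<N. real (p (Suc j)))"
    by (simp add: sum_subtractf psize_eq[of N q, OF Nq])
  also have "psize p = (\<Sum>j<Suc N. p j)" by (rule psize_eq) (use N in auto)
  then have "(\<Sum>j<N. real (p (Suc j))) = real (psize p) - real (p 0)"
    by (simp add: sum.lessThan_Suc_shift del: sum.lessThan_Suc)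
  finally have *: "(\<Sum>j\<in>?J. real (q j) - real (p (Suc j))) = real (psize q) - (real (psize p) - real (p 0))" .
  have "(\<Sum>i | i = 0 \<or> p i < q (i - 1). x + real i - real (p i))
      = x - real (p 0) + (\<Sum>j\<in>?J. x + 1 + real j - real (p (Suc j)))"
  proof -
    have "(\<Sum>i\<in>Suc ` ?J. x + real i - real (p i)) = (\<Sum>j\<in>?J. x + 1 + real j - real (p (Suc j)))"
      by (subst sum.reindex) (auto simp: o_def add_ac)
    then show ?thesis unfolding S using fJ by (subst sum.insert) auto
  qed
  also have "\<dots> = x - real (p 0) + ((\<Sum>j\<in>?J. x + 1 + real j - real (q j)) + (\<Sum>j\<in>?J. real (q j) - real (p (Suc j))))"
    by (subst sum.distrib[symmetric]) (auto intro!: sum.cong)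
  finally show ?thesis unfolding * by simp
qed

lemma addable_hstrips_inc_iff:
  assumes p: "par p"
  shows "(i \<in> addable p \<and> q \<in> hstrips (inc p i) \<and> q i \<le> p i) \<longleftrightarrow> (q \<in> hstrips p \<and> (i = 0 \<or> p i < q (i - 1)))"
    (is "?L \<longleftrightarrow> ?R")
proof
  assume L: ?L
  have "q l \<le> p l" for l using L by (cases "l = i") (auto simp: hstrips_def inc_def split: if_splits)
  moreover have "p (Suc l) \<le> q l" for l
  proof -
    have "inc p i (Suc l) \<le> q l" using L by (simp add: hstrips_def)
    then show ?thesis by (auto simp: inc_def split: if_splits)
  qed
  moreover have "p i < q (i - 1)" if "i \<noteq> 0"
  proof -
    have "inc p i (Suc (i - 1)) \<le> q (i - 1)" using L by (simp add: hstrips_def)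
    then show ?thesis using that by (simp add: inc_def)
  qed
  ultimately show ?R by (auto simp: hstrips_def)
next
  assume R: ?R
  then have h: "q l \<le> p l" "p (Suc l) \<le> q l" for l by (simp_all add: hstrips_def)
  have "i \<in> addable p" using R h(1)[of "i - 1"] by (auto simp: addable_def)
  moreover have "inc p i (Suc l) \<le> q l" for l using R h(2)[of l] by (auto simp: inc_def)
  moreover have "q l \<le> inc p i l" for l using h(1)[of l] by (auto simp: inc_def)
  ultimately show ?L using h(1) by (simp add: hstrips_def)
qed

lemma hstrips_inc_full_iff:
  assumes p: "par p"
  shows "(i \<in> addable p \<and> inc q i \<in> hstrips (inc p i) \<and> q i = p i) \<longleftrightarrow>
    (q \<in> hstrips p \<and> i \<in> addable q \<and> q i = p i)" (is "?L \<longleftrightarrow> ?R")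
proof
  assume L: ?L
  have a: "inc q i l \<le> inc p i l" "inc p i (Suc l) \<le> inc q i l" for l using L by (simp_all add: hstrips_def)
  have "q l \<le> p l" for l using a(1)[of l] L by (auto simp: inc_def split: if_splits)
  moreover have "p (Suc l) \<le> q l" for l
    using a(2)[of l] L p[unfolded par_def] by (auto simp: inc_def split: if_splits)
  moreover have "i \<in> addable q"
    using a(2)[of "i - 1"] L by (cases i) (auto simp: inc_def addable_def split: if_splits)
  ultimately show ?R using L by (simp add: hstrips_def)
next
  assume R: ?R
  then have h: "q l \<le> p l" "p (Suc l) \<le> q l" for l by (simp_all add: hstrips_def)
  have "i \<in> addable p" using R h(1)[of "i - 1"] by (auto simp: addable_def)
  moreover have "inc p i (Suc l) \<le> inc q i l" for l
    using R h(2)[of l] by (auto simp: inc_def addable_def)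
  moreover have "inc q i l \<le> inc p i l" for l using R h(1)[of l] by (auto simp: inc_def)
  ultimately show ?L using R by (simp add: hstrips_def)
qed

lemma addable_hstrips_inc_iff':
  "(q \<in> hstrips p \<and> i \<in> addable q \<and> q i < p i) \<longleftrightarrow>
   (inc q i \<in> hstrips p \<and> p (Suc i) < inc q i i)" (is "?L \<longleftrightarrow> ?R")
proof
  assume L: ?L
  then have h: "q l \<le> p l" "p (Suc l) \<le> q l" for l by (simp_all add: hstrips_def)
  have "inc q i l \<le> p l" for l using L h(1)[of l] by (auto simp: inc_def)
  moreover have "p (Suc l) \<le> inc q i l" for l using h(2)[of l] by (auto simp: inc_def)
  moreover have "p (Suc i) < inc q i i" using h(2)[of i] by (simp add: inc_def)
  ultimately show ?R by (simp add: hstrips_def)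
next
  assume R: ?R
  then have a: "inc q i l \<le> p l" "p (Suc l) \<le> inc q i l" for l by (simp_all add: hstrips_def)
  have b: "q i < p i" using a(1)[of i] by (simp add: inc_def)
  have "q l \<le> p l" for l using a(1)[of l] by (auto simp: inc_def split: if_splits)
  moreover have "p (Suc l) \<le> q l" for l using a(2)[of l] R by (auto simp: inc_def split: if_splits)
  moreover have "i \<in> addable q"
    using a(2)[of "i - 1"] b by (cases i) (auto simp: addable_def inc_def)
  ultimately show ?L using b by (simp add: hstrips_def)
qed

lemma cells_inc_inc: "q i = p i \<Longrightarrow> cells (inc p i) (inc q i) = cells p q"
  by (auto simp: cells_def inc_def split: if_splits)

lemma cells_inc_left: "q i \<le> p i \<Longrightarrow> cells (inc p i) q = insert (i, p i) (cells p q)"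
  by (auto simp: cells_def inc_def split: if_splits)

lemma cells_inc_right: "q i < p i \<Longrightarrow> cells p q = insert (i, q i) (cells p (inc q i))"
  by (auto simp: cells_def inc_def split: if_splits)

text \<open>Induction on the variables. The cell added to \<open>p\<close> falls either into the
  outermost strip or into the inner shape. In the first case
  \<open>hstrips_addable_removable\<close> turns the sum of the new factors into a scalar plus terms
  in which a cell is added to the inner shape within \<open>p\<close>. Together with the second case
  these run over all addable rows of the inner shape, and the induction hypothesis applies.\<close>

lemma shifted_schur_pieri:
  assumes "par p"
  shows "(\<Sum>i\<in>addable p. shifted_schur xs (inc p i)) = (sum_list xs - real (psize p)) * shifted_schur xs p"
  using assms
proof (induction xs arbitrary: p)
  case Nil
  have "inc p i \<noteq> (\<lambda>_. 0)" for i by (auto simp: inc_def fun_eq_iff)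
  then show ?case by simp
next
  case (Cons x xs)
  note p = Cons.prems
  define f where "f = shifted_schur xs"
  define w where "w p q = (\<Prod>(i, j)\<in>cells p q. x + real i - real j)" for p q
  have w_left: "w (inc p i) q = (x + real i - real (p i)) * w p q" if "q i \<le> p i" for i q
    unfolding w_def cells_inc_left[of q i p, OF that]
    by (subst prod.insert) (simp_all add: finite_cells p, simp add: cells_def)
  have w_right: "w p q = (x + real i - real (q i)) * w p (inc q i)" if "q i < p i" for i q
    unfolding w_def cells_inc_right[of q i p, OF that]
    by (subst prod.insert) (simp_all add: finite_cells p, simp add: cells_def inc_def)
  have fin: "finite (hstrips (inc p i))" if "i \<in> addable p" for i
    using that p by (intro finite_hstrips par_inc)
  have finH: "finite (hstrips p)" using p by (rule finite_hstrips)
  have finA: "finite (addable q)" if "q \<in> hstrips p" for q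
    using hstrips_par[OF p that] by (rule finite_addable)
  have finC: "finite {j. p (Suc j) < q j}" if "q \<in> hstrips p" for q
  proof -
    have "{j. p (Suc j) < q j} \<subseteq> {j. p (Suc j) < p j}" using hstrips_le[OF that] by (auto intro: less_le_trans)
    then show ?thesis using finite_removable[OF p] finite_subset unfolding removable_def by blast
  qed
  have finB: "finite {i. i = 0 \<or> p i < q (i - 1)}" if "q \<in> hstrips p" for q
  proof -
    have "{i. i = 0 \<or> p i < q (i - 1)} \<subseteq> addable p"
      using hstrips_le[OF that] by (auto simp: addable_def intro: less_le_trans)
    then show ?thesis using finite_addable[OF p] finite_subset by blast
  qed
  have "(\<Sum>i\<in>addable p. shifted_schur (x # xs) (inc p i))
      = (\<Sum>i\<in>addable p. (\<Sum>q\<in>{q\<in>hstrips (inc p i). q i \<le> p i}. w (inc p i) q * f q)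
           + (\<Sum>q\<in>{q\<in>hstrips (inc p i). \<not> q i \<le> p i}. w (inc p i) q * f q))"
  proof (rule sum.cong[OF refl])
    fix i assume i: "i \<in> addable p"
    have "shifted_schur (x # xs) (inc p i) = (\<Sum>q\<in>hstrips (inc p i). w (inc p i) q * f q)"
      by (simp add: w_def f_def)
    also have "\<dots> = (\<Sum>q\<in>{q\<in>hstrips (inc p i). q i \<le> p i} \<union> {q\<in>hstrips (inc p i). \<not> q i \<le> p i}. w (inc p i) q * f q)"
      by (rule sum.cong) auto
    also have "\<dots> = (\<Sum>q\<in>{q\<in>hstrips (inc p i). q i \<le> p i}. w (inc p i) q * f q)
           + (\<Sum>q\<in>{q\<in>hstrips (inc p i). \<not> q i \<le> p i}. w (inc p i) q * f q)"
      by (rule sum.union_disjoint) (use fin[OF i] in auto)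
    finally show "shifted_schur (x # xs) (inc p i) = \<dots>" .
  qed
  also have "\<dots> = (\<Sum>i\<in>addable p. \<Sum>q\<in>{q\<in>hstrips (inc p i). q i \<le> p i}. w (inc p i) q * f q)
           + (\<Sum>i\<in>addable p. \<Sum>q\<in>{q\<in>hstrips (inc p i). \<not> q i \<le> p i}. w (inc p i) q * f q)"
    by (rule sum.distrib)
  also have "(\<Sum>i\<in>addable p. \<Sum>q\<in>{q\<in>hstrips (inc p i). q i \<le> p i}. w (inc p i) q * f q)
     = (\<Sum>(i, q)\<in>(SIGMA i:addable p. {q\<in>hstrips (inc p i). q i \<le> p i}). w (inc p i) q * f q)"
    by (rule sum.Sigma) (use fin finite_addable[OF p] in auto)
  also have "\<dots> = (\<Sum>(q, i)\<in>(SIGMA q:hstrips p. {i. i = 0 \<or> p i < q (i - 1)}). (x + real i - real (p i)) * (w p q * f q))"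
  proof (rule sum.reindex_bij_witness[of _ "\<lambda>(q, i). (i, q)" "\<lambda>(i, q). (q, i)"], goal_cases)
    case (2 a)
    then show ?case using addable_hstrips_inc_iff[OF p, of "fst a" "snd a"] by auto
  next
    case (4 b)
    then show ?case using addable_hstrips_inc_iff[OF p, of "snd b" "fst b"] by auto
  next
    case (5 a)
    then show ?case using w_left[of "snd a" "fst a"] by auto
  qed auto
  also have "\<dots> = (\<Sum>q\<in>hstrips p. \<Sum>i | i = 0 \<or> p i < q (i - 1). (x + real i - real (p i)) * (w p q * f q))"
    by (rule sum.Sigma[symmetric]) (use finH finB in auto)
  also have "\<dots> = (\<Sum>q\<in>hstrips p. (x - (real (psize p) - real (psize q)) + (\<Sum>j | p (Suc j) < q j. x + 1 + real j - real (q j))) * (w p q * f q))"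
    by (rule sum.cong[OF refl]) (simp only: sum_distrib_right[symmetric] hstrips_addable_removable[OF p])
  also have "\<dots> = (\<Sum>q\<in>hstrips p. (x - (real (psize p) - real (psize q))) * (w p q * f q))
      + (\<Sum>q\<in>hstrips p. \<Sum>j | p (Suc j) < q j. (x + 1 + real j - real (q j)) * (w p q * f q))"
    unfolding distrib_right sum.distrib sum_distrib_right ..
  also have "(\<Sum>q\<in>hstrips p. \<Sum>j | p (Suc j) < q j. (x + 1 + real j - real (q j)) * (w p q * f q))
     = (\<Sum>(q, j)\<in>(SIGMA q:hstrips p. {j. p (Suc j) < q j}). (x + 1 + real j - real (q j)) * (w p q * f q))"
    by (rule sum.Sigma) (use finH finC in auto)
  \<comment> \<open>The factor \<open>x + 1 + j - q j\<close> belongs to the last cell of row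
    \<open>j\<close> of \<open>q\<close>. Moving that cell into the strip absorbs the factor into
    the weight; the inner shape becomes \<open>dec q j\<close>, and \<open>f\<close> is still
    evaluated one cell above it.\<close>
  also have "\<dots> = (\<Sum>(q, j)\<in>(SIGMA q:hstrips p. {j\<in>addable q. q j < p j}). w p q * f (inc q j))"
  proof (rule sum.reindex_bij_witness[of _ "\<lambda>(q, i). (inc q i, i)" "\<lambda>(q, i). (dec q i, i)"], goal_cases)
    case (1 a)
    then show ?case by (auto simp: inc_dec)
  next
    case (2 a)
    obtain q i where a: "a = (q, i)" by (cases a)
    have "inc (dec q i) i = q" using 2 a by (auto simp: inc_dec)
    then show ?case using 2 a addable_hstrips_inc_iff'[of "dec q i" p i] by auto
  next
    case (3 a)
    then show ?case by (auto simp: dec_inc)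
  next
    case (4 b)
    then show ?case using addable_hstrips_inc_iff'[of "fst b" p "snd b"] by auto
  next
    case (5 a)
    obtain q i where a: "a = (q, i)" by (cases a)
    have q: "inc (dec q i) i = q" "q i > 0" using 5 a by (auto simp: inc_dec)
    then have "dec q i i < p i" using 5 a hstrips_le[of q p i] by (auto simp: dec_def)
    from w_right[of "dec q i" i, OF this] q
    have "w p (dec q i) = (x + 1 + real i - real (q i)) * w p q" by (simp add: dec_def of_nat_diff algebra_simps)
    then show ?case using q(1) by (simp add: a)
  qed
  also have "\<dots> = (\<Sum>q\<in>hstrips p. \<Sum>j\<in>{j\<in>addable q. q j < p j}. w p q * f (inc q j))"
    by (rule sum.Sigma[symmetric]) (use finH finA in auto)
  also have "(\<Sum>i\<in>addable p. \<Sum>q\<in>{q\<in>hstrips (inc p i). \<not> q i \<le> p i}. w (inc p i) q * f q)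
     = (\<Sum>(i, q)\<in>(SIGMA i:addable p. {q\<in>hstrips (inc p i). \<not> q i \<le> p i}). w (inc p i) q * f q)"
    by (rule sum.Sigma) (use fin finite_addable[OF p] in auto)
  \<comment> \<open>The new cell lies in the inner shape: row \<open>i\<close> is then full in both
    shapes, and the strip with its weight is unchanged. These are the addable rows missing from the
    previous sum.\<close>
  also have "\<dots> = (\<Sum>(q, j)\<in>(SIGMA q:hstrips p. {j\<in>addable q. \<not> q j < p j}). w p q * f (inc q j))"
  proof (rule sum.reindex_bij_witness[of _ "\<lambda>(q, i). (i, inc q i)" "\<lambda>(i, q). (dec q i, i)"], goal_cases)
    case (1 a)
    then show ?case by (auto simp: inc_dec)
  next
    case (2 a)
    obtain q i where a: "a = (i, q)" by (cases a)
    have "q i = Suc (p i)" using 2 a hstrips_le[of q "inc p i" i] by (auto simp: inc_def)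
    then have "inc (dec q i) i = q" "dec q i i = p i" by (simp_all add: inc_dec) (simp add: dec_def)
    then show ?case using 2 a hstrips_inc_full_iff[OF p, of i "dec q i"] by auto
  next
    case (3 a)
    then show ?case by (auto simp: dec_inc)
  next
    case (4 b)
    obtain q i where b: "b = (q, i)" by (cases b)
    then have "q i = p i" using 4 hstrips_le[of q p i] by auto
    then show ?case using 4 b hstrips_inc_full_iff[OF p, of i q] by (auto simp: inc_def)
  next
    case (5 a)
    obtain q i where a: "a = (i, q)" by (cases a)
    have "q i = Suc (p i)" using 5 a hstrips_le[of q "inc p i" i] by (auto simp: inc_def)
    then have "inc (dec q i) i = q" "dec q i i = p i" by (simp_all add: inc_dec) (simp add: dec_def)
    then show ?case using cells_inc_inc[of "dec q i" i p] by (simp add: a w_def)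
  qed
  also have "\<dots> = (\<Sum>q\<in>hstrips p. \<Sum>j\<in>{j\<in>addable q. \<not> q j < p j}. w p q * f (inc q j))"
    by (rule sum.Sigma[symmetric]) (use finH finA in auto)
  finally have "(\<Sum>i\<in>addable p. shifted_schur (x # xs) (inc p i)) =
     (\<Sum>q\<in>hstrips p. (x - (real (psize p) - real (psize q))) * (w p q * f q)
       + ((\<Sum>j\<in>{j\<in>addable q. q j < p j}. w p q * f (inc q j)) + (\<Sum>j\<in>{j\<in>addable q. \<not> q j < p j}. w p q * f (inc q j))))"
    by (simp add: sum.distrib add.assoc)
  also have "\<dots> = (\<Sum>q\<in>hstrips p. (sum_list (x # xs) - real (psize p)) * (w p q * f q))"
  proof (rule sum.cong[OF refl])
    fix q assume q: "q \<in> hstrips p"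
    have "(\<Sum>j\<in>{j\<in>addable q. q j < p j}. w p q * f (inc q j)) + (\<Sum>j\<in>{j\<in>addable q. \<not> q j < p j}. w p q * f (inc q j))
       = (\<Sum>j\<in>{j\<in>addable q. q j < p j} \<union> {j\<in>addable q. \<not> q j < p j}. w p q * f (inc q j))"
      by (rule sum.union_disjoint[symmetric]) (use finA[OF q] in auto)
    also have "{j\<in>addable q. q j < p j} \<union> {j\<in>addable q. \<not> q j < p j} = addable q" by auto
    also have "(\<Sum>j\<in>addable q. w p q * f (inc q j)) = w p q * ((sum_list xs - real (psize q)) * f q)"
      using Cons.IH[OF hstrips_par[OF p q]] by (simp add: f_def sum_distrib_left[symmetric])
    finally show "(x - (real (psize p) - real (psize q))) * (w p q * f q)
       + ((\<Sum>j\<in>{j\<in>addable q. q j < p j}. w p q * f (inc q j)) + (\<Sum>j\<in>{j\<in>addable q. \<not> q j < p j}. w p q * f (inc q j)))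
       = (sum_list (x # xs) - real (psize p)) * (w p q * f q)" by (simp add: algebra_simps)
  qed
  finally show ?case by (simp add: sum_distrib_left w_def f_def)
qed

section \<open>Vanishing of shifted Schur functions and comparison with Schur functions\<close>

definition rows_fun :: "nat list \<Rightarrow> nat \<Rightarrow> nat" where
  "rows_fun la i = (if i < length la then la ! i else 0)"

lemma rows_fun_Nil [simp]: "rows_fun [] = (\<lambda>_. 0)"
  by (simp add: rows_fun_def fun_eq_iff)

lemma rows_fun_Cons [simp]:
  "rows_fun (x # xs) 0 = x" "rows_fun (x # xs) (Suc i) = rows_fun xs i"
  by (simp_all add: rows_fun_def)

lemma sum_list_rows_fun: "(\<Sum>i<length la. rows_fun la i) = sum_list la"
  by (induction la) (simp_all add: sum.lessThan_Suc_shift del: sum.lessThan_Suc)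

lemma psize_rows_fun: "psize (rows_fun la) = sum_list la"
  by (subst psize_eq[of "length la"]) (simp_all add: sum_list_rows_fun, simp add: rows_fun_def)

lemma par_rows_fun:
  assumes "sorted_wrt (\<ge>) la" shows "par (rows_fun la)"
  unfolding par_def
proof (intro conjI allI exI impI)
  fix i show "rows_fun la (Suc i) \<le> rows_fun la i"
    using assms by (auto simp: rows_fun_def sorted_wrt_iff_nth_less)
next
  fix i assume "length la \<le> i" then show "rows_fun la i = 0" by (simp add: rows_fun_def)
qed

lemma par_as_list:
  assumes "par p"
  obtains la where "sorted_wrt (\<ge>) la" "rows_fun la = p"
proof -
  obtain N where N: "\<And>i. i \<ge> N \<Longrightarrow> p i = 0" using assms(1) unfolding par_def by blast
  have "rows_fun (map p [0..<N]) = p" using N by (auto simp: rows_fun_def fun_eq_iff)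
  moreover have "sorted_wrt (\<ge>) (map p [0..<N])"
    using par_mono[OF assms] by (auto simp: sorted_wrt_iff_nth_less)
  ultimately show thesis using that by blast
qed

text \<open>By induction the inner shape \<open>q\<close> is contained in the tail of
  \<open>la\<close>; interlacing shifts this by one row and settles every row but the first. In row
  \<open>0\<close>, where \<open>q 0 \<le> x\<close>, a row of \<open>p\<close> longer than
  \<open>x\<close> would put the cell \<open>(0, x)\<close> into the strip, and its factor
  \<open>x + 0 - x\<close> is zero.\<close>

lemma shifted_schur_vanish:
  assumes "par p" "sorted_wrt (\<ge>) la" "shifted_schur (map real la) p \<noteq> 0"
  shows "p i \<le> rows_fun la i"
  using assms
proof (induction la arbitrary: p i)
  case Nil
  then show ?case by (auto split: if_splits)
next
  case (Cons x la)
  obtain q where q: "q \<in> hstrips p" and nz: "(\<Prod>(i, j)\<in>cells p q. real x + real i - real j) \<noteq> 0"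
    and sq: "shifted_schur (map real la) q \<noteq> 0"
  proof -
    have "\<exists>q\<in>hstrips p. (\<Prod>(i, j)\<in>cells p q. real x + real i - real j) * shifted_schur (map real la) q \<noteq> 0"
      using Cons.prems(3) sum.neutral unfolding list.map shifted_schur.simps by meson
    then show thesis using that by auto
  qed
  have "par q" using Cons.prems(1) q by (rule hstrips_par)
  then have IH: "q l \<le> rows_fun la l" for l using Cons.IH[OF _ _ sq] Cons.prems(2) by simp
  show ?case
  proof (cases i)
    case 0
    show ?thesis
    proof (rule ccontr)
      assume "\<not> ?thesis"
      then have "x < p 0" using 0 by simp
      moreover have "q 0 \<le> x"
        using IH[of 0] Cons.prems(2) by (cases la) auto
      ultimately have "(0, x) \<in> cells p q" by (simp add: cells_def)
      then show False using nz finite_cells[OF Cons.prems(1), of q] by (auto simp: prod_zero_iff)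
    qed
  next
    case (Suc l)
    have "p (Suc l) \<le> q l" using q by (simp add: hstrips_def)
    then show ?thesis using IH[of l] Suc by simp
  qed
qed

primrec schur :: "real list \<Rightarrow> (nat \<Rightarrow> nat) \<Rightarrow> real" where
  "schur [] p = (if p = (\<lambda>_. 0) then 1 else 0)"
| "schur (x # xs) p = (\<Sum>q\<in>hstrips p. x ^ (psize p - psize q) * schur xs q)"

lemma schur_nonneg: "(\<And>x. x \<in> set xs \<Longrightarrow> 0 \<le> x) \<Longrightarrow> 0 \<le> schur xs p"
  by (induction xs arbitrary: p) (auto intro!: sum_nonneg mult_nonneg_nonneg)

text \<open>On a non-vanishing term every factor \<open>x + i - j\<close> is nonnegative, so the signs in the
  definition of the shifted Schur function play no role.\<close>
lemma shifted_schur_le_schur: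
  fixes R :: real
  assumes "par p" "sorted_wrt (\<ge>) la" "R \<ge> 0" "\<And>i. p i \<noteq> 0 \<Longrightarrow> real i \<le> R"
  shows "0 \<le> shifted_schur (map real la) p \<and>
    shifted_schur (map real la) p \<le> schur (map (\<lambda>x. real x + R) la) p"
  using assms
proof (induction la arbitrary: p)
  case Nil
  then show ?case by simp
next
  case (Cons x la)
  have *: "0 \<le> (\<Prod>(i, j)\<in>cells p q. real x + real i - real j) * shifted_schur (map real la) q \<and>
      (\<Prod>(i, j)\<in>cells p q. real x + real i - real j) * shifted_schur (map real la) q
      \<le> (real x + R) ^ (psize p - psize q) * schur (map (\<lambda>x. real x + R) la) q"
    if q: "q \<in> hstrips p" for q
  proof (cases "(\<Prod>(i, j)\<in>cells p q. real x + real i - real j) * shifted_schur (map real la) q = 0")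
    case True
    have "0 \<le> (real x + R) ^ (psize p - psize q) * schur (map (\<lambda>x. real x + R) la) q"
      using Cons.prems(3) by (auto intro!: mult_nonneg_nonneg schur_nonneg)
    then show ?thesis unfolding True by simp
  next
    case nonzero: False
    then have nz: "(\<Prod>(i, j)\<in>cells p q. real x + real i - real j) \<noteq> 0"
      and False: "shifted_schur (map real la) q \<noteq> 0" by simp_all
    have pq: "par q" using Cons.prems(1) q by (rule hstrips_par)
    have sorted: "sorted_wrt (\<ge>) la" using Cons.prems(2) by simp
    have qle: "q i \<le> rows_fun la i" for i by (rule shifted_schur_vanish[OF pq sorted False])
    have la: "rows_fun la i \<le> x" for i using Cons.prems(2) by (auto simp: rows_fun_def)
    have "q i \<noteq> 0 \<Longrightarrow> real i \<le> R" for i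
      using Cons.prems(4)[of i] hstrips_le[OF q, of i] by simp
    note IH = Cons.IH[OF pq sorted Cons.prems(3) this]
    have fac: "0 \<le> real x + real i - real j \<and> real x + real i - real j \<le> real x + R"
      if "(i, j) \<in> cells p q" for i j
    proof -
      have "j < p i" using that by (simp add: cells_def)
      have "real i \<le> R" using Cons.prems(4)[of i] \<open>j < p i\<close> by simp
      moreover have "real x + real i - real j \<ge> 0"
      proof (cases i)
        case 0
        have "\<not> (0, x) \<in> cells p q" using nz finite_cells[OF Cons.prems(1), of q] by (auto simp: prod_zero_iff)
        then have "p 0 \<le> x" using qle[of 0] la[of 0] by (simp add: cells_def)
        then show ?thesis using 0 \<open>j < p i\<close> by simp
      next
        case (Suc l)
        have "p (Suc l) \<le> q l" using q by (simp add: hstrips_def)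
        then have "j < x" using qle[of l] la[of l] \<open>j < p i\<close> Suc by simp
        then show ?thesis by simp
      qed
      ultimately show ?thesis by simp
    qed
    have "0 \<le> (\<Prod>(i, j)\<in>cells p q. real x + real i - real j)"
      using fac by (intro prod_nonneg) auto
    moreover have "(\<Prod>(i, j)\<in>cells p q. real x + real i - real j) \<le> (\<Prod>(i, j)\<in>cells p q. real x + R)"
      using fac by (intro prod_mono) auto
    moreover have "(\<Prod>(i, j)\<in>cells p q. real x + R) = (real x + R) ^ (psize p - psize q)"
      using card_cells[OF Cons.prems(1), of q] hstrips_le[OF q] by (simp add: case_prod_unfold)
    ultimately show ?thesis using IH Cons.prems(3)
      by (auto intro!: mult_mono mult_nonneg_nonneg zero_le_power)
  qed
  show ?case using * by (auto intro!: sum_nonneg sum_mono)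
qed

section \<open>Removing cells and horizontal strips\<close>

text \<open>The down operator of Young's lattice, acting on functions of shapes. Applied
  \<open>m\<close> times to the indicator of \<open>q\<close> and evaluated at \<open>p\<close>, it
  counts the chains from \<open>p\<close> to \<open>q\<close> that lose one cell at a time, hence
  the standard tableaux of \<open>p / q\<close>.\<close>

definition down :: "((nat \<Rightarrow> nat) \<Rightarrow> real) \<Rightarrow> (nat \<Rightarrow> nat) \<Rightarrow> real" where
  "down F p = (\<Sum>i\<in>removable p. F (dec p i))"

definition down_strip :: "nat \<Rightarrow> ((nat \<Rightarrow> nat) \<Rightarrow> real) \<Rightarrow> (nat \<Rightarrow> nat) \<Rightarrow> real" where
  "down_strip j F p = (\<Sum>q | q \<in> hstrips p \<and> psize q + j = psize p. F q)"

definition ind :: "(nat \<Rightarrow> nat) \<Rightarrow> (nat \<Rightarrow> nat) \<Rightarrow> real" where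
  "ind q p = (if p = q then 1 else 0)"

definition std_count :: "(nat \<Rightarrow> nat) \<Rightarrow> real" where
  "std_count p = (down ^^ psize p) (ind (\<lambda>_. 0)) p"

lemma down_cong: "par p \<Longrightarrow> (\<And>q. par q \<Longrightarrow> F q = G q) \<Longrightarrow> down F p = down G p"
  unfolding down_def by (intro sum.cong) (auto intro: par_dec)

lemma down_funpow_cong:
  "par p \<Longrightarrow> (\<And>q. par q \<Longrightarrow> F q = G q) \<Longrightarrow> (down ^^ m) F p = (down ^^ m) G p"
  by (induction m arbitrary: p) (auto intro: down_cong)

lemma down_strip_cong:
  "par p \<Longrightarrow> (\<And>q. par q \<Longrightarrow> F q = G q) \<Longrightarrow> down_strip j F p = down_strip j G p"
  unfolding down_strip_def by (intro sum.cong) (auto intro: hstrips_par)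

lemma down_sum: "down (\<lambda>p. \<Sum>i\<in>A. F i p) p = (\<Sum>i\<in>A. down (F i) p)"
  unfolding down_def by (rule sum.swap)

lemma down_funpow_sum: "(down ^^ m) (\<lambda>p. \<Sum>i\<in>A. F i p) = (\<lambda>p. \<Sum>i\<in>A. (down ^^ m) (F i) p)"
proof (induction m)
  case (Suc m)
  have "(down ^^ Suc m) (\<lambda>p. \<Sum>i\<in>A. F i p) = down (\<lambda>p. \<Sum>i\<in>A. (down ^^ m) (F i) p)"
    using Suc by simp
  also have "\<dots> = (\<lambda>p. \<Sum>i\<in>A. (down ^^ Suc m) (F i) p)"
    by (rule ext) (simp add: down_sum)
  finally show ?case .
qed simp

lemma down_funpow_nonneg:
  "(\<And>q. 0 \<le> F q) \<Longrightarrow> 0 \<le> (down ^^ m) F p"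
  by (induction m arbitrary: p) (auto simp: down_def intro!: sum_nonneg)

lemma std_count_nonneg: "0 \<le> std_count p"
  unfolding std_count_def by (rule down_funpow_nonneg) (simp add: ind_def)

lemma down_funpow_ind_support:
  assumes "par p" "(down ^^ m) (ind q) p \<noteq> 0"
  shows "(\<forall>i. q i \<le> p i) \<and> psize p = psize q + m"
  using assms
proof (induction m arbitrary: p)
  case 0
  then show ?case by (auto simp: ind_def split: if_splits)
next
  case (Suc m)
  have "(\<Sum>i\<in>removable p. (down ^^ m) (ind q) (dec p i)) \<noteq> 0"
    using Suc.prems(2) by (simp add: down_def[of "(down ^^ m) (ind q)"])
  then obtain i where i: "i \<in> removable p" "(down ^^ m) (ind q) (dec p i) \<noteq> 0"
    by (meson sum.neutral)
  have IH: "(\<forall>l. q l \<le> dec p i l) \<and> psize (dec p i) = psize q + m"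
    by (rule Suc.IH) (use par_dec[OF Suc.prems(1) i(1)] i in auto)
  have "dec p i l \<le> p l" for l by (simp add: dec_def)
  then have "q l \<le> p l" for l using IH le_trans[of "q l" "dec p i l" "p l"] by simp
  then show ?case using IH psize_dec[OF Suc.prems(1) i(1)] by simp
qed

section \<open>Commutation of cell removal and strip removal\<close>

lemma removable_hstrips_dec_iff:
  assumes "q \<in> hstrips p"
  shows "(i \<in> removable p \<and> q \<in> hstrips (dec p i)) \<longleftrightarrow> q i < p i"
    and "(inc q i \<in> hstrips p \<and> i \<in> removable (inc q i)) \<longleftrightarrow> q i < p i"
proof -
  have h: "q l \<le> p l" "p (Suc l) \<le> q l" for l using assms by (simp_all add: hstrips_def)
  show "(i \<in> removable p \<and> q \<in> hstrips (dec p i)) \<longleftrightarrow> q i < p i" (is "?L \<longleftrightarrow> ?R")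
  proof
    assume ?L
    then have "q i \<le> dec p i i" "p (Suc i) < p i" by (simp_all add: hstrips_def removable_def)
    then show ?R by (simp add: dec_def)
  next
    assume R: ?R
    have "q l \<le> dec p i l" "dec p i (Suc l) \<le> q l" for l
      using h(1)[of l] h(2)[of l] R by (auto simp: dec_def)
    then show ?L using R h(2)[of i] by (simp add: hstrips_def removable_def)
  qed
  show "(inc q i \<in> hstrips p \<and> i \<in> removable (inc q i)) \<longleftrightarrow> q i < p i" (is "?L \<longleftrightarrow> ?R")
  proof
    assume ?L
    then have "inc q i i \<le> p i" by (simp add: hstrips_def)
    then show ?R by (simp add: inc_def)
  next
    assume R: ?R
    have "inc q i l \<le> p l" "p (Suc l) \<le> inc q i l" for l
      using h(1)[of l] h(2)[of l] R by (auto simp: inc_def)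
    moreover have "q (Suc i) \<le> q i" using h(1)[of "Suc i"] h(2)[of i] by simp
    ultimately show ?L by (simp add: hstrips_def removable_def inc_def)
  qed
qed

text \<open>If either order of removal is possible, \<open>p / q\<close> has exactly one column with
  two cells, in rows \<open>l\<close> and \<open>Suc l\<close>. Removing the single cell before the
  strip forces the lower of the two, removing it after the strip forces the upper one; hence the
  shift by one row.\<close>

lemma removable_hstrips_dec_iff':
  assumes p: "par p" and "q \<notin> hstrips p"
  shows "(i \<in> removable p \<and> q \<in> hstrips (dec p i)) \<longleftrightarrow>
    (\<exists>l. i = Suc l \<and> inc q l \<in> hstrips p \<and> l \<in> removable (inc q l))" (is "?L \<longleftrightarrow> ?R")
proof
  assume L: ?L
  then have h: "q l \<le> dec p i l" "dec p i (Suc l) \<le> q l" for l by (simp_all add: hstrips_def)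
  have le: "q l \<le> p l" for l using h(1)[of l] by (auto simp: dec_def split: if_splits)
  obtain l where l: "q l < p (Suc l)" using assms le unfolding hstrips_def by (auto simp: not_le)
  have i: "i = Suc l" using l h(2)[of l] by (auto simp: dec_def split: if_splits)
  have ql: "Suc (q l) = p (Suc l)" using l h(2)[of l] by (auto simp: dec_def i split: if_splits)
  have "q l < p l"
    using ql par_mono[OF p, of l "Suc l"] by simp
  have "inc q l m \<le> p m" "p (Suc m) \<le> inc q l m" for m
    using le[of m] ql h(2)[of m] \<open>q l < p l\<close> by (auto simp: inc_def dec_def i split: if_splits)
  moreover have "q (Suc l) \<le> q l" using h(1)[of "Suc l"] ql by (simp add: dec_def i split: if_splits)
  ultimately show ?R using i by (auto simp: hstrips_def removable_def inc_def)
next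
  assume ?R
  then obtain l where i: "i = Suc l" and H: "inc q l \<in> hstrips p" "l \<in> removable (inc q l)" by blast
  have h: "inc q l m \<le> p m" "p (Suc m) \<le> inc q l m" for m using H by (simp_all add: hstrips_def)
  have le: "q m \<le> p m" for m using h(1)[of m] by (auto simp: inc_def split: if_splits)
  have "q l < p (Suc l)"
  proof (rule ccontr)
    assume "\<not> ?thesis"
    then have "p (Suc m) \<le> q m" for m using h(2)[of m] by (auto simp: inc_def split: if_splits)
    then show False using assms le by (simp add: hstrips_def)
  qed
  then have ql: "Suc (q l) = p (Suc l)" using h(2)[of l] by (simp add: inc_def)
  have d: "q (Suc l) \<le> q l" using H(2) by (simp add: removable_def inc_def)
  have "q m \<le> dec p i m" "dec p i (Suc m) \<le> q m" for m
    using le[of m] h(2)[of m] ql d by (auto simp: dec_def i inc_def split: if_splits)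
  moreover have "p (Suc (Suc l)) < p (Suc l)" using h(2)[of "Suc l"] ql d by (simp add: inc_def)
  ultimately show ?L by (simp add: hstrips_def removable_def i)
qed

text \<open>These operators are the adjoints of multiplication by \<open>h_1\<close> and
  \<open>h_j\<close>. Bijectively, fix the final shape \<open>q\<close>: if \<open>p / q\<close> is
  itself a horizontal strip, the single cell comes from the same row in both orders; otherwise its
  row moves by one.\<close>

lemma down_strip_commute:
  assumes p: "par p"
  shows "down (down_strip j F) p = down_strip j (down F) p"
proof -
  let ?H = "\<lambda>p. {q. q \<in> hstrips p \<and> psize q + j = psize p}"
  have finH: "finite (?H r)" if "par r" for r using finite_hstrips[OF that] by simp
  let ?S = "SIGMA i:removable p. ?H (dec p i)"
  let ?T = "SIGMA q:?H p. removable q"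
  have S: "(i, q) \<in> ?S \<longleftrightarrow> i \<in> removable p \<and> q \<in> hstrips (dec p i) \<and> par q \<and> psize q + Suc j = psize p" for i q
    using psize_dec[OF p, of i] hstrips_par[OF par_dec[OF p, of i], of q] by auto
  have T: "(inc q l, l) \<in> ?T \<longleftrightarrow> inc q l \<in> hstrips p \<and> l \<in> removable (inc q l) \<and> par q \<and> psize q + Suc j = psize p" for q l
    using psize_dec[of "inc q l" l] hstrips_par[OF p, of "inc q l"] par_dec[of "inc q l" l]
    by (auto simp: dec_inc)
  have "down (down_strip j F) p = (\<Sum>(i, q)\<in>?S. F q)"
    unfolding down_def down_strip_def
    by (rule sum.Sigma) (use finite_removable[OF p] finH par_dec[OF p] in auto)
  also have "\<dots> = (\<Sum>(q, l)\<in>?T. F (dec q l))"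
  proof (rule sum.reindex_bij_witness[of _
      "\<lambda>(q, l). if dec q l \<in> hstrips p then (l, dec q l) else (Suc l, dec q l)"
      "\<lambda>(i, q). if q \<in> hstrips p then (inc q i, i) else (inc q (i - 1), i - 1)"], goal_cases)
    case (1 a)
    obtain i q where a: "a = (i, q)" by (cases a)
    show ?case
    proof (cases "q \<in> hstrips p")
      case False
      then obtain l where "i = Suc l" using 1 a S removable_hstrips_dec_iff'[OF p False, of i] by auto
      then show ?thesis using False by (simp add: a dec_inc)
    qed (simp add: a dec_inc)
  next
    case (2 a)
    obtain i q where a: "a = (i, q)" by (cases a)
    have s: "i \<in> removable p \<and> q \<in> hstrips (dec p i)" "par q" "psize q + Suc j = psize p" using 2 S a by auto
    show ?case
    proof (cases "q \<in> hstrips p")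
      case True
      then have "inc q i \<in> hstrips p \<and> i \<in> removable (inc q i)" using s removable_hstrips_dec_iff[OF True, of i] by simp
      then have "(inc q i, i) \<in> ?T" using s T by blast
      then show ?thesis using True by (simp add: a)
    next
      case False
      then obtain l where l: "i = Suc l" "inc q l \<in> hstrips p \<and> l \<in> removable (inc q l)"
        using s removable_hstrips_dec_iff'[OF p False, of i] by auto
      then have "(inc q l, l) \<in> ?T" using s T by blast
      then show ?thesis using False l by (simp add: a)
    qed
  next
    case (3 b)
    obtain q l where b: "b = (q, l)" by (cases b)
    have "inc (dec q l) l = q" using 3 b by (intro inc_dec) (auto simp: removable_def)
    then show ?case by (auto simp: b)
  next
    case (4 b)
    obtain q l where b: "b = (q, l)" by (cases b)
    define r where "r = dec q l"
    have q: "q = inc r l" unfolding r_def using 4 b by (intro inc_dec[symmetric]) (auto simp: removable_def)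
    have t: "inc r l \<in> hstrips p \<and> l \<in> removable (inc r l)" "par r" "psize r + Suc j = psize p"
      using 4 T[of r l] b q by auto
    show ?case
    proof (cases "r \<in> hstrips p")
      case True
      then have "(l, r) \<in> ?S" unfolding S using t removable_hstrips_dec_iff[OF True, of l] by simp
      then show ?thesis using True by (simp add: b r_def)
    next
      case False
      then have "(Suc l, r) \<in> ?S" unfolding S using t removable_hstrips_dec_iff'[OF p False, of "Suc l"] by simp
      then show ?thesis using False by (simp add: b r_def)
    qed
  next
    case (5 a)
    obtain i q where a: "a = (i, q)" by (cases a)
    then show ?case by (auto simp: dec_inc)
  qed
  also have "\<dots> = down_strip j (down F) p"
    unfolding down_def down_strip_def
    by (rule sum.Sigma[symmetric]) (use finite_removable hstrips_par[OF p] finH[OF p] in auto)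
  finally show ?thesis .
qed

lemma down_funpow_strip_commute:
  "par p \<Longrightarrow> (down ^^ m) (down_strip j F) p = down_strip j ((down ^^ m) F) p"
proof (induction m arbitrary: p)
  case (Suc m)
  have "(down ^^ Suc m) (down_strip j F) p = down ((down ^^ m) (down_strip j F)) p" by simp
  also have "\<dots> = down (down_strip j ((down ^^ m) F)) p"
    using Suc.prems Suc.IH by (rule down_cong)
  also have "\<dots> = down_strip j ((down ^^ Suc m) F) p" using down_strip_commute[OF Suc.prems] by simp
  finally show ?case .
qed simp

section \<open>The Okounkov--Olshanski formula\<close>

lemma down_ind:
  assumes p: "par p" and q: "par q"
  shows "down (ind q) p = (\<Sum>i\<in>addable q. ind (inc q i) p)"
proof -
  have eq: "{i\<in>removable p. dec p i = q} = {i\<in>addable q. inc q i = p}"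
  proof (intro set_eqI iffI)
    fix i assume "i \<in> {i\<in>removable p. dec p i = q}"
    then have i: "p (Suc i) < p i" and dq: "dec p i = q" by (auto simp: removable_def)
    have "inc q i = p" using i dq inc_dec[of p i] by auto
    moreover have "i \<in> addable q"
      using i dq par_mono[OF p, of "i - 1" i] by (cases i) (auto simp: addable_def dec_def)
    ultimately show "i \<in> {i\<in>addable q. inc q i = p}" by simp
  next
    fix i assume "i \<in> {i\<in>addable q. inc q i = p}"
    then have i: "inc q i = p" by simp
    have "i \<in> removable p" using i par_mono[OF q, of i "Suc i"] by (auto simp: removable_def inc_def)
    then show "i \<in> {i\<in>removable p. dec p i = q}" using i dec_inc[of q i] by auto
  qed
  have "down (ind q) p = real (card {i\<in>removable p. dec p i = q})"
    unfolding down_def ind_def using finite_removable[OF p] by (simp add: sum.If_cases Int_def)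
  also have "\<dots> = (\<Sum>i\<in>addable q. ind (inc q i) p)"
    unfolding eq ind_def using finite_addable[OF q] by (simp add: sum.If_cases Int_def eq_commute)
  finally show ?thesis .
qed

text \<open>Splits a chain at its inner end, whereas the definition of \<open>down\<close> splits it
  at the outer end. This is the recursion in \<open>q\<close> to be matched with
  \<open>shifted_schur_pieri\<close>.\<close>

lemma down_funpow_ind_Suc:
  assumes "par p" "par q"
  shows "(down ^^ Suc m) (ind q) p = (\<Sum>i\<in>addable q. (down ^^ m) (ind (inc q i)) p)"
proof -
  have "(down ^^ Suc m) (ind q) p = (down ^^ m) (down (ind q)) p" by (simp add: funpow_swap1)
  also have "\<dots> = (down ^^ m) (\<lambda>p. \<Sum>i\<in>addable q. ind (inc q i) p) p"
    using assms by (intro down_funpow_cong down_ind)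
  finally show ?thesis by (simp add: down_funpow_sum)
qed

lemma shifted_schur_zero [simp]: "shifted_schur xs (\<lambda>_. 0) = 1"
proof (induction xs)
  case (Cons x xs)
  have "hstrips (\<lambda>_. 0) = {\<lambda>_. 0}" by (auto simp: hstrips_def)
  moreover have "cells (\<lambda>_. 0) (\<lambda>_. 0) = {}" by (simp add: cells_def)
  ultimately show ?case using Cons by simp
qed simp

text \<open>Descending induction on \<open>q\<close>. The variables sum to \<open>n\<close>, so the
  coefficient in \<open>shifted_schur_pieri\<close> is \<open>n - psize q = Suc m\<close>, which
  turns \<open>fact m\<close> into \<open>fact (Suc m)\<close>. At full size, vanishing leaves only
  \<open>q = rows_fun la\<close>.\<close>

lemma shifted_schur_down:
  assumes la: "sorted_wrt (\<ge>) la" and "par q" "psize q + m = psize (rows_fun la)"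
  shows "fact m * shifted_schur (map real la) q =
    shifted_schur (map real la) (rows_fun la) * (down ^^ m) (ind q) (rows_fun la)"
  using assms(2,3)
proof (induction m arbitrary: q)
  case 0
  show ?case
  proof (cases "shifted_schur (map real la) q = 0")
    case False
    have "q = rows_fun la"
      by (rule psize_le_eq[OF par_rows_fun[OF la] shifted_schur_vanish[OF 0(1) la False]]) (use 0 in simp)
    then show ?thesis by (simp add: ind_def)
  next
    case True
    then show ?thesis by (auto simp: ind_def)
  qed
next
  case (Suc m)
  let ?t = "shifted_schur (map real la)"
  have "sum_list (map real la) = real (sum_list la)" by (induction la) simp_all
  then have n: "sum_list (map real la) = real (psize q + Suc m)"
    by (simp only: Suc.prems(2) psize_rows_fun)
  have "fact (Suc m) * ?t q = fact m * ((sum_list (map real la) - real (psize q)) * ?t q)"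
    unfolding n by (simp add: algebra_simps)
  also have "\<dots> = (\<Sum>i\<in>addable q. fact m * ?t (inc q i))"
    by (simp only: shifted_schur_pieri[OF Suc.prems(1), symmetric] sum_distrib_left)
  also have "\<dots> = (\<Sum>i\<in>addable q. ?t (rows_fun la) * (down ^^ m) (ind (inc q i)) (rows_fun la))"
    using Suc.prems by (intro sum.cong[OF refl] Suc.IH par_inc) (auto simp: psize_inc)
  also have "\<dots> = ?t (rows_fun la) * (down ^^ Suc m) (ind q) (rows_fun la)"
    unfolding down_funpow_ind_Suc[OF par_rows_fun[OF la] Suc.prems(1)] by (simp add: sum_distrib_left)
  finally show ?case .
qed

text \<open>The constant \<open>shifted_schur (map real la) (rows_fun la)\<close> of the previous
  lemma is eliminated by applying that lemma also to the empty shape, where the shifted Schur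
  function equals \<open>1\<close> and the chains are counted by \<open>std_count\<close>.\<close>

lemma okounkov_olshanski:
  assumes la: "sorted_wrt (\<ge>) la" and q: "par q" "psize q + m = psize (rows_fun la)"
  shows "fact m * shifted_schur (map real la) q * std_count (rows_fun la) =
    fact (psize (rows_fun la)) * (down ^^ m) (ind q) (rows_fun la)"
  using shifted_schur_down[OF la q] shifted_schur_down[OF la par_zero, of "psize (rows_fun la)"]
  by (simp add: std_count_def)

section \<open>One-row shapes\<close>

definition one_row :: "nat \<Rightarrow> nat \<Rightarrow> nat" where
  "one_row j = (\<lambda>i. if i = 0 then j else 0)"

lemma psize_one_row [simp]: "psize (one_row j) = j"
  by (subst psize_eq[of 1]) (auto simp: one_row_def)

lemma par_one_row [simp]: "par (one_row j)"
  by (auto simp: par_def one_row_def)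

lemma hstrips_one_row: "hstrips (one_row j) = one_row ` {..j}"
proof (intro set_eqI iffI)
  fix q assume "q \<in> hstrips (one_row j)"
  then have q: "q i \<le> one_row j i" for i by (rule hstrips_le)
  have "q i = one_row (q 0) i" for i using q[of i] by (cases i) (auto simp: one_row_def)
  then have "q = one_row (q 0)" by (rule ext)
  then show "q \<in> one_row ` {..j}" using q[of 0] by (auto simp: one_row_def)
qed (auto simp: hstrips_def one_row_def)

lemma down_strip_ind_zero: assumes "par p" shows "down_strip j (ind (\<lambda>_. 0)) p = ind (one_row j) p"
proof -
  have "(\<lambda>_. 0) \<in> hstrips p \<and> psize p = j \<longleftrightarrow> p = one_row j"
  proof
    assume L: "(\<lambda>_. 0) \<in> hstrips p \<and> psize p = j"
    then have "p (Suc i) = 0" for i by (simp add: hstrips_def)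
    then have "p = one_row (p 0)" by (auto simp: one_row_def fun_eq_iff gr0_conv_Suc)
    then show "p = one_row j" using L by (metis psize_one_row)
  next
    assume "p = one_row j"
    then show "(\<lambda>_. 0) \<in> hstrips p \<and> psize p = j" by (simp add: hstrips_def) (simp add: one_row_def)
  qed
  then show ?thesis using finite_hstrips[OF assms] unfolding down_strip_def ind_def
    by (auto simp: sum.If_cases)
qed

text \<open>Commuting the strip past all single cells postpones its removal to the end, and a
  horizontal strip that leaves nothing behind must be a row. So the tableaux of \<open>p\<close>
  ending in a \<open>j\<close>-strip are as many as the standard tableaux of \<open>p / (j)\<close>,
  a number accessible to \<open>okounkov_olshanski\<close>.\<close>

lemma down_strip_std_count:
  assumes "par p" "psize p = m + j"
  shows "down_strip j std_count p = (down ^^ m) (ind (one_row j)) p"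
proof -
  have "down_strip j std_count p = down_strip j ((down ^^ m) (ind (\<lambda>_. 0))) p"
    unfolding down_strip_def std_count_def by (rule sum.cong) (use assms in auto)
  also have "\<dots> = (down ^^ m) (down_strip j (ind (\<lambda>_. 0))) p"
    by (rule down_funpow_strip_commute[symmetric]) (rule assms)
  also have "\<dots> = (down ^^ m) (ind (one_row j)) p"
    using assms(1) down_strip_ind_zero by (rule down_funpow_cong)
  finally show ?thesis .
qed

section \<open>Standard Young tableaux as chains\<close>

definition corners :: "(nat \<times> nat) set \<Rightarrow> (nat \<times> nat) set" where
  "corners D = {(i, j). (i, j) \<in> D \<and> (i, Suc j) \<notin> D \<and> (Suc i, j) \<notin> D}"

lemma finite_SYT: assumes "finite D" shows "finite (SYT D)"
proof -
  have "finite {T. \<forall>c. (c \<in> D \<longrightarrow> T c \<in> {1..card D}) \<and> (c \<notin> D \<longrightarrow> T c = (0::nat))}"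
    by (rule finite_set_of_finite_funs) (use assms in auto)
  moreover have "SYT D \<subseteq> {T. \<forall>c. (c \<in> D \<longrightarrow> T c \<in> {1..card D}) \<and> (c \<notin> D \<longrightarrow> T c = (0::nat))}"
    unfolding SYT_def using bij_betwE by blast
  ultimately show ?thesis by (rule finite_subset[rotated])
qed

lemma SYT_remove_max_bij:
  assumes D: "finite D" and c: "c \<in> corners D"
  shows "bij_betw (\<lambda>T. T(c := 0)) {T \<in> SYT D. T c = card D} (SYT (D - {c}))"
proof (rule bij_betw_byWitness[where f' = "\<lambda>T. T(c := card D)"])
  have cD: "c \<in> D" using c by (auto simp: corners_def)
  have card: "card (D - {c}) = card D - 1" "card D > 0" using D cD by (auto simp: card_gt_0_iff)
  show "\<forall>T\<in>{T \<in> SYT D. T c = card D}. (T(c := 0))(c := card D) = T" by auto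
  show "\<forall>T\<in>SYT (D - {c}). (T(c := card D))(c := 0) = T"
    by (auto simp: SYT_def fun_eq_iff)
  show "(\<lambda>T. T(c := 0)) ` {T \<in> SYT D. T c = card D} \<subseteq> SYT (D - {c})"
  proof (rule image_subsetI)
    fix T assume "T \<in> {T \<in> SYT D. T c = card D}"
    then have T: "T \<in> SYT D" "T c = card D" by auto
    have "bij_betw T (D - {c}) ({1..card D} - {card D})"
      by (rule bij_betw_DiffI) (use T cD card in \<open>auto simp: SYT_def\<close>)
    also have "{1..card D} - {card D} = {1..card (D - {c})}" using card by auto
    finally have "bij_betw (T(c := 0)) (D - {c}) {1..card (D - {c})}"
      by (rule bij_betw_cong[THEN iffD1, rotated]) auto
    then show "T(c := 0) \<in> SYT (D - {c})" using T(1) by (auto simp: SYT_def)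
  qed
  show "(\<lambda>T. T(c := card D)) ` SYT (D - {c}) \<subseteq> {T \<in> SYT D. T c = card D}"
  proof (rule image_subsetI)
    fix T assume T: "T \<in> SYT (D - {c})"
    let ?T = "T(c := card D)"
    have b: "bij_betw T (D - {c}) {1..card D - 1}" using T card by (simp add: SYT_def)
    then have "bij_betw ?T (D - {c}) {1..card D - 1}"
      by (rule bij_betw_cong[THEN iffD1, rotated]) auto
    then have "bij_betw ?T ((D - {c}) \<union> {c}) ({1..card D - 1} \<union> {?T c})"
      by (rule notIn_Un_bij_betw[rotated 2]) (use card in auto)
    moreover have "(D - {c}) \<union> {c} = D" using cD by auto
    moreover have "{1..card D - 1} \<union> {?T c} = {1..card D}" using card by auto
    ultimately have bij: "bij_betw ?T D {1..card D}" by simp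
    have lt: "T d < card D" if "d \<in> D" "d \<noteq> c" for d
    proof -
      have "T d \<in> {1..card D - 1}" using bij_betwE[OF b] that by blast
      then show ?thesis using card by auto
    qed
    obtain a b where ab: "c = (a, b)" by (cases c)
    have nb: "(a, Suc b) \<notin> D" "(Suc a, b) \<notin> D" using c ab by (auto simp: corners_def)
    have "?T (i, j) < ?T (i, Suc j)" if "(i, j) \<in> D" "(i, Suc j) \<in> D" for i j
    proof -
      have "(i, j) \<noteq> c" using that nb ab by auto
      then show ?thesis using lt[of "(i, j)"] that T by (auto simp: SYT_def)
    qed
    moreover have "?T (i, j) < ?T (Suc i, j)" if "(i, j) \<in> D" "(Suc i, j) \<in> D" for i j
    proof -
      have "(i, j) \<noteq> c" using that nb ab by auto
      then show ?thesis using lt[of "(i, j)"] that T by (auto simp: SYT_def)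
    qed
    moreover have "\<forall>d. d \<notin> D \<longrightarrow> ?T d = 0" using T cD by (auto simp: SYT_def)
    ultimately show "?T \<in> {T \<in> SYT D. T c = card D}" using bij by (simp add: SYT_def)
  qed
qed

text \<open>The largest entry sits in a corner, since a neighbour to its right or below it would
  carry a larger one; deleting it is invertible.\<close>

lemma card_SYT_corners:
  assumes D: "finite D" "D \<noteq> {}"
  shows "card (SYT D) = (\<Sum>c\<in>corners D. card (SYT (D - {c})))"
proof -
  let ?X = "\<lambda>c. {T \<in> SYT D. T c = card D}"
  have fc: "finite (corners D)" using D(1) by (rule finite_subset[rotated]) (auto simp: corners_def)
  have "SYT D = (\<Union>c\<in>corners D. ?X c)"
  proof (intro set_eqI iffI)
    fix T assume T: "T \<in> SYT D"
    then have bij: "bij_betw T D {1..card D}" by (simp add: SYT_def)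
    have "card D \<in> {1..card D}" using D by (auto simp: Suc_le_eq card_gt_0_iff)
    then obtain c where c: "c \<in> D" "T c = card D" using bij unfolding bij_betw_def by (metis imageE)
    obtain i j where ij: "c = (i, j)" by (cases c)
    have le: "T d \<le> card D" if "d \<in> D" for d using bij_betwE[OF bij] that by auto
    have "(i, Suc j) \<notin> D"
    proof
      assume d: "(i, Suc j) \<in> D"
      then have "T (i, j) < T (i, Suc j)" using T c(1) d unfolding ij SYT_def by blast
      then show False using le[OF d] c ij by simp
    qed
    moreover have "(Suc i, j) \<notin> D"
    proof
      assume d: "(Suc i, j) \<in> D"
      then have "T (i, j) < T (Suc i, j)" using T c(1) d unfolding ij SYT_def by blast
      then show False using le[OF d] c ij by simp
    qed
    ultimately have "c \<in> corners D" using c ij by (simp add: corners_def)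
    then show "T \<in> (\<Union>c\<in>corners D. ?X c)" using T c by blast
  qed auto
  then have "card (SYT D) = card (\<Union>c\<in>corners D. ?X c)" by simp
  also have "\<dots> = (\<Sum>c\<in>corners D. card (?X c))"
  proof (rule card_UN_disjoint[OF fc])
    show "\<forall>c\<in>corners D. finite (?X c)" using finite_SYT[OF D(1)] by simp
    show "\<forall>c\<in>corners D. \<forall>d\<in>corners D. c \<noteq> d \<longrightarrow> ?X c \<inter> ?X d = {}"
    proof (intro ballI impI)
      fix c d assume cd: "c \<in> corners D" "d \<in> corners D" "c \<noteq> d"
      have "False" if "T \<in> SYT D" "T c = card D" "T d = card D" for T
      proof -
        have "inj_on T D" using that(1) by (simp add: SYT_def bij_betw_def)
        moreover have "c \<in> D" "d \<in> D" using cd by (auto simp: corners_def)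
        ultimately show False using that cd(3) by (metis inj_onD)
      qed
      then show "?X c \<inter> ?X d = {}" by blast
    qed
  qed
  also have "\<dots> = (\<Sum>c\<in>corners D. card (SYT (D - {c})))"
    by (rule sum.cong[OF refl]) (rule bij_betw_same_card[OF SYT_remove_max_bij[OF D(1)]])
  finally show ?thesis .
qed

lemma corners_cells:
  assumes p: "par p" and q: "par q"
  shows "corners (cells p q) = (\<lambda>i. (i, p i - 1)) ` {i \<in> removable p. q i < p i}"
proof (intro set_eqI iffI)
  fix c assume c: "c \<in> corners (cells p q)"
  obtain i j where ij: "c = (i, j)" by (cases c)
  have h: "q i \<le> j" "j < p i" "(i, Suc j) \<notin> cells p q" "(Suc i, j) \<notin> cells p q"
    using c ij by (auto simp: corners_def cells_def)
  have "j = p i - 1" using h by (auto simp: cells_def)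
  moreover have "p (Suc i) < p i"
    using h par_mono[OF q, of i "Suc i"] par_mono[OF p, of i "Suc i"] by (auto simp: cells_def)
  ultimately show "c \<in> (\<lambda>i. (i, p i - 1)) ` {i \<in> removable p. q i < p i}"
    using h ij by (auto simp: removable_def)
next
  fix c assume "c \<in> (\<lambda>i. (i, p i - 1)) ` {i \<in> removable p. q i < p i}"
  then show "c \<in> corners (cells p q)" by (auto simp: corners_def cells_def removable_def)
qed

lemma cells_dec: "q i < p i \<Longrightarrow> cells p q - {(i, p i - 1)} = cells (dec p i) q"
  by (auto simp: cells_def dec_def split: if_splits)

lemma card_SYT_cells:
  assumes "par p" "par q" "\<And>i. q i \<le> p i" "psize p = psize q + m"
  shows "real (card (SYT (cells p q))) = (down ^^ m) (ind q) p"
  using assms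
proof (induction m arbitrary: p)
  case 0
  then have "q = p" by (intro psize_le_eq) auto
  moreover have "SYT {} = {\<lambda>_. 0}" by (auto simp: SYT_def bij_betw_def)
  moreover have "cells p p = {}" by (auto simp: cells_def)
  ultimately show ?case by (simp add: ind_def)
next
  case (Suc m)
  have fin: "finite (cells p q)" using Suc.prems(1) by (rule finite_cells)
  have "card (cells p q) = Suc m" using card_cells[of p q] Suc.prems by simp
  then have ne: "cells p q \<noteq> {}" by auto
  \<comment> \<open>The sum defining \<open>down\<close> runs over all removable rows of
    \<open>p\<close>, the sum over corners only over those longer in \<open>p\<close> than in
    \<open>q\<close>. In the other rows, removing a cell destroys the containment of
    \<open>q\<close>.\<close>
  have zero: "(down ^^ m) (ind q) (dec p i) = 0" if "i \<in> removable p" "\<not> q i < p i" for i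
  proof (rule ccontr)
    assume "\<not> ?thesis"
    then have "q i \<le> dec p i i" using down_funpow_ind_support[OF par_dec[OF Suc.prems(1) that(1)]] by blast
    then show False using that by (simp add: dec_def removable_def)
  qed
  have "real (card (SYT (cells p q))) = (\<Sum>c\<in>corners (cells p q). real (card (SYT (cells p q - {c}))))"
    by (simp add: card_SYT_corners[OF fin ne])
  also have "\<dots> = (\<Sum>i | i \<in> removable p \<and> q i < p i. real (card (SYT (cells p q - {(i, p i - 1)}))))"
    unfolding corners_cells[OF Suc.prems(1,2)] by (subst sum.reindex) (auto simp: inj_on_def)
  also have "\<dots> = (\<Sum>i | i \<in> removable p \<and> q i < p i. (down ^^ m) (ind q) (dec p i))"
  proof (rule sum.cong[OF refl])
    fix i assume i: "i \<in> {i. i \<in> removable p \<and> q i < p i}"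
    have "real (card (SYT (cells (dec p i) q))) = (down ^^ m) (ind q) (dec p i)"
    proof (rule Suc.IH)
      show "par (dec p i)" using Suc.prems(1) i by (auto intro: par_dec)
      show "q l \<le> dec p i l" for l using i Suc.prems(3)[of l] by (auto simp: dec_def)
      show "psize (dec p i) = psize q + m" using psize_dec[OF Suc.prems(1), of i] i Suc.prems(4) by simp
    qed (rule Suc.prems(2))
    then show "real (card (SYT (cells p q - {(i, p i - 1)}))) = (down ^^ m) (ind q) (dec p i)"
      using i cells_dec[of q i p] by simp
  qed
  also have "\<dots> = (\<Sum>i\<in>removable p. (down ^^ m) (ind q) (dec p i))"
    by (rule sum.mono_neutral_left) (use zero finite_removable[OF Suc.prems(1)] in auto)
  also have "\<dots> = (down ^^ Suc m) (ind q) p" by (simp add: down_def[of "(down ^^ m) (ind q)"])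
  finally show ?case .
qed

section \<open>Proportion of tableaux ending in a horizontal strip\<close>

text \<open>The rising factorial with step \<open>M\<close>. For \<open>M > 0\<close> it is
  \<open>n!\<close> times the coefficient of \<open>t^n\<close> in \<open>(1 - M t)^(-x/M)\<close>,
  a series that is multiplicative in \<open>x\<close> and, for \<open>0 \<le> x \<le> M\<close>,
  dominates \<open>1 / (1 - x t)\<close> coefficientwise.\<close>

definition rise :: "real \<Rightarrow> real \<Rightarrow> nat \<Rightarrow> real" where
  "rise M x n = (\<Prod>r<n. x + real r * M)"

lemma rise_vandermonde:
  assumes "M > 0"
  shows "rise M (x + y) n = (\<Sum>k\<le>n. real (n choose k) * rise M x k * rise M y (n - k))"
proof -
  have r: "rise M x n = M ^ n * pochhammer (x / M) n" for x n
    using assms by (induction n) (simp_all add: rise_def pochhammer_Suc field_simps)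
  have "rise M (x + y) n = (\<Sum>k\<le>n. M ^ n * (real (n choose k) * pochhammer (x / M) k * pochhammer (y / M) (n - k)))"
    unfolding r add_divide_distrib pochhammer_binomial_sum sum_distrib_left ..
  also have "\<dots> = (\<Sum>k\<le>n. real (n choose k) * rise M x k * rise M y (n - k))"
  proof (rule sum.cong[OF refl])
    fix k assume "k \<in> {..n}"
    then have "M ^ n = M ^ k * M ^ (n - k)" by (simp flip: power_add)
    then show "M ^ n * (real (n choose k) * pochhammer (x / M) k * pochhammer (y / M) (n - k)) =
       real (n choose k) * rise M x k * rise M y (n - k)" unfolding r by simp
  qed
  finally show ?thesis .
qed

lemma rise_nonneg: "0 \<le> x \<Longrightarrow> 0 \<le> M \<Longrightarrow> 0 \<le> rise M x n"
  unfolding rise_def by (intro prod_nonneg) auto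

text \<open>The coefficient of \<open>t^k\<close> in the product, over the entries \<open>x\<close>
  of the list, of the series with coefficients \<open>\<phi> x j\<close>.\<close>

primrec comp_sum :: "(real \<Rightarrow> nat \<Rightarrow> real) \<Rightarrow> real list \<Rightarrow> nat \<Rightarrow> real" where
  "comp_sum \<phi> [] k = (if k = 0 then 1 else 0)"
| "comp_sum \<phi> (x # xs) k = (\<Sum>j\<le>k. \<phi> x j * comp_sum \<phi> xs (k - j))"

text \<open>Coefficientwise domination of each factor by \<open>(1 - M t)^(-x/M)\<close> passes to
  the product, and the dominating product depends on the entries only through their sum.\<close>

lemma comp_sum_le_rise:
  assumes "M > 0" and "\<And>x. x \<in> set xs \<Longrightarrow> 0 \<le> x"
    and "\<And>x j. x \<in> set xs \<Longrightarrow> 0 \<le> \<phi> x j \<and> fact j * \<phi> x j \<le> rise M x j"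
  shows "0 \<le> comp_sum \<phi> xs k \<and> fact k * comp_sum \<phi> xs k \<le> rise M (sum_list xs) k"
  using assms(2,3)
proof (induction xs arbitrary: k)
  case Nil
  then show ?case using assms(1) by (auto intro!: rise_nonneg) (simp add: rise_def)
next
  case (Cons x xs)
  have IH: "0 \<le> comp_sum \<phi> xs k" "fact k * comp_sum \<phi> xs k \<le> rise M (sum_list xs) k" for k
    using Cons.IH[of k] Cons.prems by auto
  have x: "0 \<le> \<phi> x j" "fact j * \<phi> x j \<le> rise M x j" for j using Cons.prems(2)[of x j] by auto
  have "fact k * comp_sum \<phi> (x # xs) k = (\<Sum>j\<le>k. real (k choose j) * (fact j * \<phi> x j) * (fact (k - j) * comp_sum \<phi> xs (k - j)))"
    unfolding comp_sum.simps sum_distrib_left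
  proof (rule sum.cong[OF refl])
    fix j assume "j \<in> {..k}"
    then have "(fact k :: real) = real (k choose j) * fact j * fact (k - j)"
      using arg_cong[OF binomial_fact_lemma[of j k], of real] by (simp add: mult_ac)
    then show "fact k * (\<phi> x j * comp_sum \<phi> xs (k - j)) =
        real (k choose j) * (fact j * \<phi> x j) * (fact (k - j) * comp_sum \<phi> xs (k - j))" by simp
  qed
  also have "\<dots> \<le> (\<Sum>j\<le>k. real (k choose j) * rise M x j * rise M (sum_list xs) (k - j))"
    by (intro sum_mono mult_mono mult_left_mono mult_nonneg_nonneg x IH)
      (use Cons.prems(1) assms(1) in \<open>auto intro!: rise_nonneg\<close>)
  also have "\<dots> = rise M (sum_list (x # xs)) k" using rise_vandermonde[OF assms(1)] by simp
  finally show ?case using x IH by (auto intro!: sum_nonneg)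
qed

lemma schur_one_row: "schur xs (one_row j) = comp_sum (\<lambda>x a. x ^ a) xs j"
proof (induction xs arbitrary: j)
  case Nil
  have "one_row j = (\<lambda>_. 0) \<longleftrightarrow> j = 0" by (auto simp: one_row_def fun_eq_iff)
  then show ?case by simp
next
  case (Cons x xs)
  have "inj_on one_row {..j}"
  proof (rule inj_onI)
    fix a b assume "one_row a = one_row b"
    then have "one_row a 0 = one_row b 0" by simp
    then show "a = b" by (simp add: one_row_def)
  qed
  then have "schur (x # xs) (one_row j) = (\<Sum>i\<le>j. x ^ (j - i) * comp_sum (\<lambda>x a. x ^ a) xs i)"
    by (simp add: hstrips_one_row sum.reindex Cons)
  also have "\<dots> = (\<Sum>i\<le>j. x ^ i * comp_sum (\<lambda>x a. x ^ a) xs (j - i))"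
    by (rule sum.reindex_bij_witness[of _ "\<lambda>i. j - i" "\<lambda>i. j - i"]) auto
  finally show ?case by simp
qed

lemma power_le_rise:
  assumes "0 \<le> x" "x \<le> M" shows "fact j * x ^ j \<le> rise M x j"
proof -
  have "fact j * x ^ j = (\<Prod>r<j. x + real r * x)"
    by (induction j) (simp_all add: algebra_simps)
  also have "\<dots> \<le> rise M x j"
    unfolding rise_def using assms by (intro prod_mono) (auto intro: mult_left_mono)
  finally show ?thesis .
qed

lemma down_strip_std_count_le_rise:
  assumes p: "par p" "psize p = m + j" and R: "R > 0" "real (p 0) \<le> R"
  shows "fact j * fact (m + j) * down_strip j std_count p \<le> rise R (real (m + j)) j * fact m * std_count p"
proof -
  obtain la where la: "sorted_wrt (\<ge>) la" "rows_fun la = p" using par_as_list[OF p(1)] by blast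
  let ?x = "map real la"
  have x: "0 \<le> x \<and> x \<le> R" if xin: "x \<in> set ?x" for x
  proof -
    obtain i where i: "i < length la" "x = real (la ! i)" using xin by (auto simp: in_set_conv_nth)
    then have "x = real (p i)" unfolding la(2)[symmetric] by (simp add: rows_fun_def)
    then show ?thesis using par_mono[OF p(1), of 0 i] R by simp
  qed
  have sl: "sum_list (map real la) = real (m + j)"
  proof -
    have "sum_list (map real la) = real (sum_list la)" by (induction la) simp_all
    then show ?thesis using psize_rows_fun[of la] unfolding la(2) p(2) by simp
  qed
  \<comment> \<open>The shift is \<open>0\<close> because a one-row shape has cells in row
    \<open>0\<close> only.\<close>
  have "shifted_schur ?x (one_row j) \<le> schur (map (\<lambda>x. real x + 0) la) (one_row j)"
    by (rule shifted_schur_le_schur[THEN conjunct2]) (simp_all add: la(1), simp add: one_row_def split: if_splits)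
  also have "\<dots> = comp_sum (\<lambda>x a. x ^ a) ?x j" by (simp add: schur_one_row)
  finally have t: "fact j * shifted_schur ?x (one_row j) \<le> fact j * comp_sum (\<lambda>x a. x ^ a) ?x j" by simp
  also have "\<dots> \<le> rise R (sum_list ?x) j"
    using x power_le_rise R by (intro comp_sum_le_rise[THEN conjunct2]) auto
  finally have t: "fact j * shifted_schur ?x (one_row j) \<le> rise R (real (m + j)) j" unfolding sl .
  have "fact j * fact (m + j) * down_strip j std_count p = fact j * (fact m * shifted_schur ?x (one_row j) * std_count p)"
  proof -
    have "psize (one_row j) + m = psize (rows_fun la)" by (simp only: la(2) p(2) psize_one_row add.commute)
    from okounkov_olshanski[OF la(1) par_one_row this] show ?thesis
      unfolding la(2) p(2) down_strip_std_count[OF p] mult.assoc by (rule arg_cong[OF sym])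
  qed
  also have "\<dots> = (fact j * shifted_schur ?x (one_row j)) * (fact m * std_count p)" by simp
  also have "\<dots> \<le> rise R (real (m + j)) j * (fact m * std_count p)"
    using t std_count_nonneg by (intro mult_right_mono) auto
  finally show ?thesis by simp
qed

text \<open>A row has a single standard filling, so every standard tableau of \<open>p / (j)\<close>
  extends to one of \<open>p\<close>. In terms of chains, lengthening the row by a cell is one of
  the nonnegative terms of \<open>down_funpow_ind_Suc\<close>.\<close>

lemma down_strip_std_count_le:
  assumes "par p" "psize p = m + j"
  shows "down_strip j std_count p \<le> std_count p"
proof -
  have "(down ^^ m) (ind (one_row j)) p \<le> (down ^^ (m + j)) (ind (\<lambda>_. 0)) p" for m
  proof (induction j arbitrary: m)
    case 0
    have "one_row 0 = (\<lambda>_. 0)" by (auto simp: one_row_def)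
    then show ?case by simp
  next
    case (Suc j)
    have r: "inc (one_row j) 0 = one_row (Suc j)" by (auto simp: inc_def one_row_def)
    have "(down ^^ m) (ind (one_row (Suc j))) p \<le> (\<Sum>i\<in>addable (one_row j). (down ^^ m) (ind (inc (one_row j) i)) p)"
      unfolding r[symmetric]
    proof (rule member_le_sum)
      show "0 \<in> addable (one_row j)" by (simp add: addable_def)
      show "0 \<le> (down ^^ m) (ind (inc (one_row j) i)) p" for i
        by (rule down_funpow_nonneg) (simp add: ind_def)
    qed (simp add: finite_addable)
    also have "\<dots> = (down ^^ Suc m) (ind (one_row j)) p"
      by (rule down_funpow_ind_Suc[OF assms(1) par_one_row, symmetric])
    also have "\<dots> \<le> (down ^^ (Suc m + j)) (ind (\<lambda>_. 0)) p" by (rule Suc)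
    finally show ?case unfolding add_Suc_shift .
  qed
  then show ?thesis unfolding down_strip_std_count[OF assms] std_count_def[of p] assms(2) .
qed

section \<open>Expansion of Schur functions by content\<close>

text \<open>With \<open>F\<close> the indicator of the empty shape this is the Kostka number of
  content \<open>a\<close>. A general \<open>F\<close> leaves room for removing the remaining cells
  one at a time.\<close>

primrec kostka :: "nat list \<Rightarrow> ((nat \<Rightarrow> nat) \<Rightarrow> real) \<Rightarrow> (nat \<Rightarrow> nat) \<Rightarrow> real" where
  "kostka [] F = F"
| "kostka (j # a) F = down_strip j (kostka a F)"

definition comps :: "nat \<Rightarrow> nat \<Rightarrow> nat list set" where
  "comps N k = {a. length a = N \<and> sum_list a = k}"

lemma comps_0: "comps 0 k = (if k = 0 then {[]} else {})"
  by (auto simp: comps_def)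

lemma comps_Suc: "comps (Suc N) k = (\<lambda>(j, a). j # a) ` (SIGMA j:{..k}. comps N (k - j))"
proof (intro set_eqI iffI)
  fix a assume "a \<in> comps (Suc N) k"
  then obtain j b where "a = j # b" "length b = N" "j + sum_list b = k"
    by (cases a) (auto simp: comps_def)
  then show "a \<in> (\<lambda>(j, a). j # a) ` (SIGMA j:{..k}. comps N (k - j))"
    by (intro image_eqI[of _ _ "(j, b)"]) (auto simp: comps_def)
qed (auto simp: comps_def)

lemma finite_comps: "finite (comps N k)"
  by (induction N arbitrary: k) (simp_all add: comps_0 comps_Suc)

lemma sum_comps_Suc: "(\<Sum>a\<in>comps (Suc N) k. g a) = (\<Sum>j\<le>k. \<Sum>a\<in>comps N (k - j). g (j # a))"
  unfolding comps_Suc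
  by (subst sum.reindex) (auto simp: inj_on_def sum.Sigma finite_comps case_prod_unfold)

lemma comp_sum_eq: "comp_sum \<phi> xs k = (\<Sum>a\<in>comps (length xs) k. prod_list (map2 \<phi> xs a))"
  by (induction xs arbitrary: k) (simp_all add: comps_0 sum_comps_Suc sum_distrib_left)

lemma schur_eq_kostka:
  assumes "par p"
  shows "schur xs p = (\<Sum>a\<in>comps (length xs) (psize p). prod_list (map2 (^) xs a) * kostka a (ind (\<lambda>_. 0)) p)"
  using assms
proof (induction xs arbitrary: p)
  case Nil
  then show ?case using psize_eq_0[OF Nil] by (auto simp: comps_0 ind_def)
next
  case (Cons x xs)
  note p = Cons.prems
  let ?K = "\<lambda>a. kostka a (ind (\<lambda>_. 0))"
  have "schur (x # xs) p = (\<Sum>j\<le>psize p. \<Sum>q | q \<in> hstrips p \<and> psize p - psize q = j. x ^ (psize p - psize q) * schur xs q)"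
    unfolding schur.simps
    by (rule sum.group[symmetric]) (use finite_hstrips[OF p] in auto)
  also have "\<dots> = (\<Sum>j\<le>psize p. \<Sum>a\<in>comps (length xs) (psize p - j). prod_list (map2 (^) (x # xs) (j # a)) * ?K (j # a) p)"
  proof (rule sum.cong[OF refl])
    fix j assume j: "j \<in> {..psize p}"
    have H: "{q. q \<in> hstrips p \<and> psize p - psize q = j} = {q. q \<in> hstrips p \<and> psize q + j = psize p}" (is "_ = ?H")
      using psize_hstrips[OF p] j by (fastforce intro!: set_eqI)
    have "(\<Sum>q | q \<in> hstrips p \<and> psize p - psize q = j. x ^ (psize p - psize q) * schur xs q)
       = (\<Sum>q\<in>?H. \<Sum>a\<in>comps (length xs) (psize p - j). x ^ j * (prod_list (map2 (^) xs a) * ?K a q))"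
      unfolding H
    proof (rule sum.cong[OF refl])
      fix q assume q: "q \<in> ?H"
      then have "psize q = psize p - j" "psize p - psize q = j" by auto
      then show "x ^ (psize p - psize q) * schur xs q
        = (\<Sum>a\<in>comps (length xs) (psize p - j). x ^ j * (prod_list (map2 (^) xs a) * ?K a q))"
        using Cons.IH[OF hstrips_par[OF p], of q] q by (simp add: sum_distrib_left)
    qed
    also have "\<dots> = (\<Sum>a\<in>comps (length xs) (psize p - j). \<Sum>q\<in>?H. x ^ j * (prod_list (map2 (^) xs a) * ?K a q))"
      by (rule sum.swap)
    also have "\<dots> = (\<Sum>a\<in>comps (length xs) (psize p - j). prod_list (map2 (^) (x # xs) (j # a)) * ?K (j # a) p)"
      by (simp add: down_strip_def sum_distrib_left mult.assoc)
    finally show "(\<Sum>q | q \<in> hstrips p \<and> psize p - psize q = j. x ^ (psize p - psize q) * schur xs q)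
       = (\<Sum>a\<in>comps (length xs) (psize p - j). prod_list (map2 (^) (x # xs) (j # a)) * ?K (j # a) p)" .
  qed
  also have "\<dots> = (\<Sum>a\<in>comps (length (x # xs)) (psize p). prod_list (map2 (^) (x # xs) a) * ?K a p)"
    by (simp only: sum_comps_Suc list.size(4) add_0_right add_Suc_right One_nat_def)
  finally show ?case .
qed

section \<open>Postponing the letters that occur once\<close>

lemma down_strip_0: assumes "par p" shows "down_strip 0 F p = F p"
proof -
  have "p \<in> hstrips p" using assms by (simp add: hstrips_def par_def)
  then have "{q. q \<in> hstrips p \<and> psize q + 0 = psize p} = {p}"
    using psize_le_eq[OF assms] hstrips_le[of _ p] by auto
  then show ?thesis by (simp add: down_strip_def)
qed

lemma down_strip_1: assumes p: "par p" shows "down_strip (Suc 0) F p = down F p"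
proof -
  have "{q. q \<in> hstrips p \<and> psize q + Suc 0 = psize p} = dec p ` removable p"
  proof (intro set_eqI iffI)
    fix q assume "q \<in> {q. q \<in> hstrips p \<and> psize q + Suc 0 = psize p}"
    then have q: "q \<in> hstrips p" "Suc (psize q) = psize p" by auto
    have "\<exists>i. q i \<noteq> p i" using q(2) by (metis ext n_not_Suc_n)
    then obtain i where i: "q i < p i" using hstrips_le[OF q(1)] by (metis le_neq_implies_less)
    have "inc q i = p"
    proof (rule psize_le_eq[OF p])
      show "inc q i l \<le> p l" for l using hstrips_le[OF q(1), of l] i by (auto simp: inc_def)
      show "psize (inc q i) = psize p" using psize_inc[OF hstrips_par[OF p q(1)]] q(2) by simp
    qed
    then have "q = dec p i" using dec_inc[of q i] by simp
    moreover have "p (Suc i) \<le> q i" using q(1) by (simp add: hstrips_def)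
    ultimately show "q \<in> dec p ` removable p" using i by (auto simp: removable_def)
  next
    fix q assume "q \<in> dec p ` removable p"
    then obtain i where i: "i \<in> removable p" "q = dec p i" by blast
    have "dec p i l \<le> p l" "p (Suc l) \<le> dec p i l" for l
      using i(1) par_mono[OF p, of l "Suc l"] by (auto simp: dec_def removable_def)
    then show "q \<in> {q. q \<in> hstrips p \<and> psize q + Suc 0 = psize p}"
      using i psize_dec[OF p i(1)] by (simp add: hstrips_def)
  qed
  moreover have "inj_on (dec p) (removable p)"
  proof (rule inj_onI)
    fix i l assume "i \<in> removable p" "l \<in> removable p" "dec p i = dec p l"
    then have "dec p i i = dec p l i" "0 < p i" by (auto simp: removable_def)
    then show "i = l" by (auto simp: dec_def split: if_splits)
  qed
  ultimately show ?thesis unfolding down_strip_def down_def by (simp add: sum.reindex)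
qed

lemma kostka_down: "par p \<Longrightarrow> down (kostka a F) p = kostka a (down F) p"
proof (induction a arbitrary: p)
  case (Cons j a)
  have "down (kostka (j # a) F) p = down_strip j (down (kostka a F)) p"
    using down_strip_commute[OF Cons.prems] by simp
  also have "\<dots> = kostka (j # a) (down F) p"
    using down_strip_cong[OF Cons.prems Cons.IH] by simp
  finally show ?case .
qed simp

text \<open>Strips of size \<open>0\<close> do nothing, and strips of size \<open>1\<close> are
  applications of \<open>down\<close>, which commute to the innermost position. While the larger
  strips are removed, at least \<open>count_list a 1\<close> cells must therefore still be
  present.\<close>

lemma kostka_filter:
  "par p \<Longrightarrow> kostka a F p = kostka (filter (\<lambda>j. 2 \<le> j) a) ((down ^^ count_list a 1) F) p"
proof (induction a arbitrary: p)
  case (Cons j a)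
  let ?G = "kostka (filter (\<lambda>j. 2 \<le> j) a) ((down ^^ count_list a 1) F)"
  have *: "kostka (j # a) F p = down_strip j ?G p"
    using down_strip_cong[OF Cons.prems Cons.IH] by simp
  consider "j = 0" | "j = 1" | "2 \<le> j" by linarith
  then show ?case
  proof cases
    case 1
    then show ?thesis using * down_strip_0[OF Cons.prems] by simp
  next
    case 2
    then show ?thesis using * down_strip_1[OF Cons.prems] kostka_down[OF Cons.prems] by simp
  next
    case 3
    then show ?thesis using * by simp
  qed
qed simp

section \<open>Kostka numbers compared with the number of standard tableaux\<close>

lemma down_strip_mono:
  "(\<And>q. q \<in> hstrips p \<Longrightarrow> psize q + j = psize p \<Longrightarrow> F q \<le> G q) \<Longrightarrow> down_strip j F p \<le> down_strip j G p"
  unfolding down_strip_def by (rule sum_mono) auto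

lemma down_strip_scale: "down_strip j (\<lambda>q. c * F q) p = c * down_strip j F p"
  unfolding down_strip_def by (simp add: sum_distrib_left)

lemma down_strip_large: "psize p < j \<Longrightarrow> down_strip j F p = 0"
  by (auto simp: down_strip_def)

text \<open>The trivial estimate, each strip having proportion at most \<open>1\<close>. It serves
  the contents with many repeated letters.\<close>

lemma kostka_le_std_count:
  assumes "par p" shows "kostka a ((down ^^ m) (ind (\<lambda>_. 0))) p \<le> std_count p"
  using assms
proof (induction a arbitrary: p)
  case Nil
  show ?case
  proof (cases "(down ^^ m) (ind (\<lambda>_. 0)) p = 0")
    case True
    then show ?thesis using std_count_nonneg by simp
  next
    case False
    then have "psize p = m" using down_funpow_ind_support[OF Nil] by simp
    then show ?thesis by (simp add: std_count_def)
  qed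
next
  case (Cons j a)
  have le: "kostka (j # a) ((down ^^ m) (ind (\<lambda>_. 0))) p \<le> down_strip j std_count p"
    unfolding kostka.simps by (rule down_strip_mono) (rule Cons.IH[OF hstrips_par[OF Cons.prems]])
  also have "\<dots> \<le> std_count p"
  proof (cases "j \<le> psize p")
    case True
    then show ?thesis by (intro down_strip_std_count_le[of p "psize p - j"] Cons.prems) simp
  next
    case False
    then show ?thesis using std_count_nonneg down_strip_large[of p j] by simp
  qed
  finally show ?case .
qed

lemma kostka_small:
  assumes "par p" "psize p < m" shows "kostka a ((down ^^ m) (ind (\<lambda>_. 0))) p = 0"
  using assms
proof (induction a arbitrary: p)
  case Nil
  then show ?case using down_funpow_ind_support[OF Nil(1), of m "\<lambda>_. 0"] by auto
next
  case (Cons j a)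
  then show ?case unfolding kostka.simps down_strip_def
    by (intro sum.neutral) (auto intro!: Cons.IH intro: hstrips_par)
qed

text \<open>\<open>rise \<rho> 1 j / j!\<close> bounds the proportion of standard tableaux whose last \<open>j\<close> entries form a
  horizontal strip filled from left to right.\<close>
lemma down_strip_std_count_le_ratio:
  assumes p: "par p" "psize p = n + j" and R: "R > 0" "real (p 0) \<le> R" and \<rho>: "0 \<le> \<rho>" "R + 1 \<le> \<rho> * real n"
  shows "down_strip j std_count p \<le> rise \<rho> 1 j / fact j * std_count p"
proof -
  have f: "(fact (n + j) :: real) = (\<Prod>r<j. real (n + j) - real r) * fact n"
  proof (induction j)
    case (Suc j)
    have "(\<Prod>r<Suc j. real (n + Suc j) - real r) = real (n + Suc j) * (\<Prod>r<j. real (n + j) - real r)"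
      unfolding prod.lessThan_Suc_shift by (auto intro!: prod.cong)
    then show ?case using Suc by simp
  qed simp
  have "rise R (real (n + j)) j \<le> (\<Prod>r<j. (real (n + j) - real r) * (1 + real r * \<rho>))"
    unfolding rise_def
  proof (rule prod_mono)
    fix r assume r: "r \<in> {..<j}"
    \<comment> \<open>Origin of the hypothesis on \<open>\<rho>\<close>: expanding
      \<open>(n + j - r) * (1 + r * \<rho>)\<close> reduces the factorwise inequality to this one,
      and \<open>n + j - r\<close> is at least \<open>n\<close>.\<close>
    have "real r * (R + 1) \<le> real r * (\<rho> * (real (n + j) - real r))"
      using \<rho> r by (intro mult_left_mono order_trans[OF \<rho>(2)] mult_left_mono) auto
    then show "0 \<le> real (n + j) + real r * R \<and> real (n + j) + real r * R \<le> (real (n + j) - real r) * (1 + real r * \<rho>)"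
      using R by (auto simp: algebra_simps)
  qed
  also have "\<dots> = (\<Prod>r<j. real (n + j) - real r) * rise \<rho> 1 j"
    by (simp add: rise_def prod.distrib)
  finally have r: "rise R (real (n + j)) j * fact n \<le> fact (n + j) * rise \<rho> 1 j"
    unfolding f by (simp add: mult.commute mult.left_commute)
  have "fact (n + j) * (fact j * down_strip j std_count p) \<le> rise R (real (n + j)) j * fact n * std_count p"
    using down_strip_std_count_le_rise[OF p R] by (simp add: mult_ac)
  also have "\<dots> \<le> fact (n + j) * rise \<rho> 1 j * std_count p"
    using r std_count_nonneg by (intro mult_right_mono) auto
  finally have "fact j * down_strip j std_count p \<le> rise \<rho> 1 j * std_count p"
    by (simp add: mult.assoc)
  then show ?thesis by (simp add: field_simps)
qed

text \<open>The proportions multiply. Each strip leaves at least the \<open>m\<close> cells reserved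
  for the single removals, and the first row never exceeds \<open>R\<close>, so one
  \<open>\<rho>\<close> serves all strips.\<close>

lemma kostka_le_ratio:
  assumes "par p" "R > 0" "real (p 0) \<le> R" and \<rho>: "0 \<le> \<rho>" "R + 1 \<le> \<rho> * real m"
  shows "kostka a ((down ^^ m) (ind (\<lambda>_. 0))) p \<le> prod_list (map (\<lambda>j. rise \<rho> 1 j / fact j) a) * std_count p"
  using assms(1,3)
proof (induction a arbitrary: p)
  case Nil
  then show ?case using kostka_le_std_count[OF Nil(1), of "[]"] by simp
next
  case (Cons j a)
  let ?K = "kostka a ((down ^^ m) (ind (\<lambda>_. 0)))"
  define c where "c = prod_list (map (\<lambda>j. rise \<rho> 1 j / fact j) a)"
  have c: "0 \<le> c" unfolding c_def using rise_nonneg[of 1 \<rho>] \<rho> by (auto intro!: prod_list_nonneg)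
  have w: "0 \<le> rise \<rho> 1 j / fact j" using rise_nonneg[of 1 \<rho>] \<rho> by simp
  show ?case
  proof (cases "m + j \<le> psize p")
    case True
    define n where "n = psize p - j"
    have n: "psize p = n + j" "m \<le> n" using True by (auto simp: n_def)
    have "kostka (j # a) ((down ^^ m) (ind (\<lambda>_. 0))) p \<le> down_strip j (\<lambda>q. c * std_count q) p"
      unfolding kostka.simps
    proof (rule down_strip_mono)
      fix q assume q: "q \<in> hstrips p"
      have "real (q 0) \<le> R" using hstrips_le[OF q, of 0] Cons.prems(2) by simp
      then show "?K q \<le> c * std_count q" unfolding c_def by (rule Cons.IH[OF hstrips_par[OF Cons.prems(1) q]])
    qed
    also have "\<dots> = c * down_strip j std_count p" by (rule down_strip_scale)
    also have "\<dots> \<le> c * (rise \<rho> 1 j / fact j * std_count p)"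
    proof (rule mult_left_mono[OF down_strip_std_count_le_ratio[OF Cons.prems(1) n(1) assms(2) Cons.prems(2) \<rho>(1)] c])
      have "\<rho> * real m \<le> \<rho> * real n" using n(2) \<rho>(1) by (intro mult_left_mono) auto
      then show "R + 1 \<le> \<rho> * real n" using \<rho>(2) by linarith
    qed
    finally show ?thesis by (simp add: c_def mult_ac)
  next
    case False
    \<comment> \<open>After this strip fewer than \<open>m\<close> cells are left, too few for the
      \<open>m\<close> single removals at the end.\<close>
    have "kostka (j # a) ((down ^^ m) (ind (\<lambda>_. 0))) p = 0"
      unfolding kostka.simps down_strip_def
    proof (rule sum.neutral, rule ballI)
      fix q assume "q \<in> {q. q \<in> hstrips p \<and> psize q + j = psize p}"
      then have "par q" "psize q < m" using False hstrips_par[OF Cons.prems(1)] by auto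
      then show "?K q = 0" by (rule kostka_small)
    qed
    moreover have "0 \<le> prod_list (map (\<lambda>j. rise \<rho> 1 j / fact j) (j # a)) * std_count p"
      unfolding list.map prod_list.Cons
      using c w std_count_nonneg by (intro mult_nonneg_nonneg) (simp_all add: c_def)
    ultimately show ?thesis by simp
  qed
qed

section \<open>Upper bound for Schur functions\<close>

lemma sum_list_filter_count: "sum_list (filter (\<lambda>j. 2 \<le> j) a) + count_list a 1 = sum_list (a :: nat list)"
proof (induction a)
  case (Cons j a)
  consider "j = 0" | "j = 1" | "2 \<le> j" by linarith
  then show ?case using Cons by cases auto
qed simp

lemma prod_list_filter_trivial:
  fixes g :: "nat \<Rightarrow> real"
  assumes "g 0 = 1" "g 1 = 1"
  shows "prod_list (map g (filter (\<lambda>j. 2 \<le> j) a)) = prod_list (map g a)"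
proof (induction a)
  case (Cons j a)
  consider "j = 0" | "j = 1" | "2 \<le> j" by linarith
  then show ?case using Cons assms by cases auto
qed simp

lemma prod_list_map2_mult:
  fixes f h :: "real \<Rightarrow> nat \<Rightarrow> real"
  assumes "length a = length xs"
  shows "prod_list (map2 f xs a) * prod_list (map g a) = prod_list (map2 (\<lambda>x j. f x j * g j) xs a)"
  using assms by (induction xs arbitrary: a) (auto simp: length_Suc_conv mult_ac)

lemma prod_list_power_filter:
  fixes z :: real
  shows "prod_list (map (\<lambda>j. if 2 \<le> j then z ^ j else 1) a) = z ^ sum_list (filter (\<lambda>j. 2 \<le> j) a)"
  by (induction a) (auto simp: power_add)

lemma sum_list_filter_ge_2:
  "0 < sum_list (filter (\<lambda>j. 2 \<le> j) a) \<Longrightarrow> 2 \<le> sum_list (filter (\<lambda>j. 2 \<le> j) (a :: nat list))"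
  by (induction a) auto

text \<open>A single nonnegative term of a power series at \<open>t\<close> is at most the value of
  the series, here a product of factors each bounded by an exponential.\<close>

lemma comp_sum_le_exp:
  assumes t: "0 \<le> t" and "\<And>x j. x \<in> set xs \<Longrightarrow> 0 \<le> \<phi> x j"
    and "\<And>x k. x \<in> set xs \<Longrightarrow> (\<Sum>j\<le>k. \<phi> x j * t ^ j) \<le> exp (c * x)"
  shows "comp_sum \<phi> xs k * t ^ k \<le> exp (c * sum_list xs)"
  using assms(2,3)
proof (induction xs arbitrary: k)
  case Nil
  then show ?case by simp
next
  case (Cons x xs)
  have IH: "comp_sum \<phi> xs k * t ^ k \<le> exp (c * sum_list xs)" for k using Cons.IH Cons.prems by simp
  have "comp_sum \<phi> (x # xs) k * t ^ k = (\<Sum>j\<le>k. (\<phi> x j * t ^ j) * (comp_sum \<phi> xs (k - j) * t ^ (k - j)))"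
    unfolding comp_sum.simps sum_distrib_right
  proof (rule sum.cong[OF refl])
    fix j assume "j \<in> {..k}"
    then have "t ^ k = t ^ j * t ^ (k - j)" by (simp flip: power_add)
    then show "\<phi> x j * comp_sum \<phi> xs (k - j) * t ^ k = (\<phi> x j * t ^ j) * (comp_sum \<phi> xs (k - j) * t ^ (k - j))"
      by simp
  qed
  also have "\<dots> \<le> (\<Sum>j\<le>k. (\<phi> x j * t ^ j) * exp (c * sum_list xs))"
    using Cons.prems(1) t by (intro sum_mono mult_left_mono IH) auto
  also have "\<dots> \<le> exp (c * x) * exp (c * sum_list xs)"
    unfolding sum_distrib_right[symmetric] using Cons.prems(2) by (intro mult_right_mono) auto
  also have "\<dots> = exp (c * sum_list (x # xs))" by (simp add: exp_add distrib_left)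
  finally show ?case .
qed

lemma sum_powers_le_2:
  fixes v :: real assumes "0 \<le> v" "v \<le> 1/2" shows "(\<Sum>j<n. v ^ j) \<le> 2"
proof (induction n)
  case (Suc n)
  have "(\<Sum>j<Suc n. v ^ j) = 1 + v * (\<Sum>j<n. v ^ j)"
    by (simp add: sum.lessThan_Suc_shift sum_distrib_left del: sum.lessThan_Suc)
  also have "v * (\<Sum>j<n. v ^ j) \<le> 1/2 * 2"
    using assms Suc by (intro mult_mono) (auto intro: sum_nonneg)
  finally show ?case by simp
qed simp

text \<open>The terms from \<open>j = 2\<close> on form a geometric series of ratio at most
  \<open>1/2\<close>, so they sum to at most \<open>2 * (z * u)^2\<close>; the condition
  \<open>z^2 * u \<le> 1\<close> makes this at most \<open>2 * u\<close>.\<close>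

lemma weighted_powers_le_exp:
  fixes u z :: real
  assumes "0 \<le> u" "0 \<le> z" "z * u \<le> 1/2" "z ^ 2 * u \<le> 1"
  shows "(\<Sum>j\<le>k. u ^ j * (if 2 \<le> j then z ^ j else 1)) \<le> exp (3 * u)"
proof -
  let ?g = "\<lambda>j. u ^ j * (if 2 \<le> j then z ^ j else 1)"
  have nn: "0 \<le> ?g j" for j using assms by simp
  have "(\<Sum>j\<le>k. ?g j) \<le> (\<Sum>j<Suc (Suc k). ?g j)"
    by (rule sum_mono2) (use nn in auto)
  also have "\<dots> = 1 + u + (\<Sum>j<k. ?g (Suc (Suc j)))"
    by (simp add: sum.lessThan_Suc_shift del: sum.lessThan_Suc)
  also have "(\<Sum>j<k. ?g (Suc (Suc j))) = (z * u) ^ 2 * (\<Sum>j<k. (z * u) ^ j)"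
    by (simp add: sum_distrib_left power2_eq_square power_mult_distrib mult_ac)
  also have "\<dots> \<le> (z * u) ^ 2 * 2"
    using assms by (intro mult_left_mono sum_powers_le_2) auto
  also have "(z * u) ^ 2 * 2 = 2 * u * (z ^ 2 * u)" by (simp add: power2_eq_square)
  also have "\<dots> \<le> 2 * u * 1" using assms by (intro mult_left_mono) auto
  finally have "(\<Sum>j\<le>k. ?g j) \<le> 1 + 3 * u" by simp
  also have "\<dots> \<le> exp (3 * u)" by (rule exp_ge_add_one_self)
  finally show ?thesis .
qed

text \<open>The counterpart of \<open>power_le_rise\<close> for damped letters: replacing
  \<open>fact j\<close> by \<open>rise \<rho> 1 j\<close> reduces the step from \<open>M\<close> to
  \<open>\<rho> * M\<close>, which is the source of the saving.\<close>

lemma power_mult_rise_le: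
  assumes "0 \<le> x" "x \<le> M" "0 \<le> \<rho>" shows "x ^ j * rise \<rho> 1 j \<le> rise (\<rho> * M) x j"
proof -
  have "x ^ j * rise \<rho> 1 j = (\<Prod>r<j. x + real r * (\<rho> * x))"
    by (induction j) (simp_all add: rise_def algebra_simps)
  also have "\<dots> \<le> rise (\<rho> * M) x j"
    unfolding rise_def using assms by (intro prod_mono) (auto intro!: mult_left_mono)
  finally show ?thesis .
qed

lemma rise_le_exp:
  assumes "X > 0" "M \<ge> 0" shows "rise M X k \<le> X ^ k * exp (real k ^ 2 * M / X)"
proof -
  have "rise M X k \<le> (\<Prod>r<k. X * exp (real k * M / X))"
    unfolding rise_def
  proof (rule prod_mono)
    fix r assume r: "r \<in> {..<k}"
    have "real r * M \<le> real k * M" using r assms by (intro mult_right_mono) auto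
    moreover have "X * (1 + real k * M / X) = X + real k * M" using assms by (simp add: field_simps)
    ultimately have "X + real r * M \<le> X * (1 + real k * M / X)" by linarith
    also have "\<dots> \<le> X * exp (real k * M / X)"
      using assms by (intro mult_left_mono exp_ge_add_one_self) auto
    finally show "0 \<le> X + real r * M \<and> X + real r * M \<le> X * exp (real k * M / X)"
      using assms by simp
  qed
  also have "\<dots> = X ^ k * exp (real k ^ 2 * M / X)"
    by (simp add: power_mult_distrib power2_eq_square mult.assoc flip: exp_of_nat_mult)
  finally show ?thesis .
qed

text \<open>Words with more than half of their letters repeated. The weight \<open>z = \<epsilon> powr (-1/2)\<close> per repeated
  letter makes their total contribution a Chernoff-type tail.\<close>
lemma repeated_letters_tail:
  assumes k: "k > 0" and M: "\<And>x. x \<in> set xs \<Longrightarrow> 0 \<le> x \<and> x \<le> M" and X: "X = sum_list xs" "X > 0"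
    and eps: "\<epsilon> = M * real k / X" "0 < \<epsilon>" "\<epsilon> \<le> exp (-12)"
  shows "fact k * (\<Sum>a\<in>comps (length xs) k. if 2 * count_list a 1 < k then prod_list (map2 (^) xs a) else 0)
    \<le> X ^ k * (exp 12 * \<epsilon>)"
proof -
  \<comment> \<open>The weight \<open>z = 1 / y\<close> is the largest one allowed by
    \<open>weighted_powers_le_exp\<close>: for \<open>u \<le> \<epsilon>\<close> it gives
    \<open>z^2 * u \<le> 1\<close> and \<open>z * u \<le> y\<close>.\<close>
  define y where "y = sqrt \<epsilon>"
  define z where "z = 1 / y"
  define g where "g j = (if 2 \<le> j then z ^ j else 1)" for j :: nat
  define \<phi> where "\<phi> x j = x ^ j * g j" for x and j :: nat
  \<comment> \<open>With this evaluation point \<open>fact k \<le> real k ^ k = t^k * X^k\<close>,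
    and every \<open>x * t\<close> is at most \<open>\<epsilon>\<close>. The generating function
    then costs \<open>exp (3 * t * X) = exp (3 * real k)\<close>.\<close>
  define t where "t = real k / X"
  have y: "0 < y" "y ^ 2 = \<epsilon>" using eps by (simp_all add: y_def)
  \<comment> \<open>Origin of the threshold \<open>exp (-12)\<close>: it makes
    \<open>exp 6 * y \<le> 1\<close>, so that the decay \<open>y^s\<close> outweighs the loss
    \<open>exp (3 * real k)\<close>.\<close>
  have "y \<le> exp (-6)"
    unfolding y_def by (rule real_le_lsqrt) (use eps in \<open>auto simp: power2_eq_square simp flip: exp_add\<close>)
  then have e6: "exp 6 * y \<le> 1"
    by (simp add: exp_minus field_simps)
  have "(2::real) \<le> exp 6" using exp_ge_add_one_self[of 6] by simp
  then have "2 * y \<le> exp 6 * y" using y by (intro mult_right_mono) auto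
  then have y2: "y \<le> 1/2" using e6 by simp
  have t: "0 < t" using k X by (simp add: t_def)
  have z: "0 < z" "z * y = 1" using y by (simp_all add: z_def)
  have tail: "prod_list (map2 (^) xs a) \<le> prod_list (map2 \<phi> xs a) * (exp 12 * \<epsilon> * exp (- 3 * real k))"
    if a: "a \<in> comps (length xs) k" and few: "2 * count_list a 1 < k" for a
  proof -
    define s where "s = sum_list (filter (\<lambda>j. 2 \<le> j) a)"
    have len: "length a = length xs" "s + count_list a 1 = k"
      using a sum_list_filter_count[of a] by (auto simp: comps_def s_def)
    \<comment> \<open>The repeated letters occupy \<open>s > k / 2\<close> positions, so
      \<open>exp (3 * real k)\<close> is at most \<open>(exp 6)^s\<close>. A repeated letter
      occupies at least two positions, so \<open>s \<ge> 2\<close>, and the final bound is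
      \<open>(exp 6 * y)^2 = exp 12 * \<epsilon>\<close>.\<close>
    have s: "k < 2 * s" "2 \<le> s"
      using len few sum_list_filter_ge_2[of a] unfolding s_def by linarith+
    have p0: "0 \<le> prod_list (map2 (^) xs a)"
      using M by (intro prod_list_nonneg) (auto dest!: set_zip_leftD)
    have "prod_list (map2 \<phi> xs a) = prod_list (map2 (^) xs a) * z ^ s"
      unfolding \<phi>_def prod_list_map2_mult[OF len(1), symmetric] s_def g_def prod_list_power_filter ..
    then have eq: "prod_list (map2 (^) xs a) = prod_list (map2 \<phi> xs a) * y ^ s"
      using z by (simp add: mult.assoc flip: power_mult_distrib)
    have "y ^ s * exp (3 * real k) \<le> y ^ s * exp (6 * real s)"
      using s y by (intro mult_left_mono) auto
    also have "\<dots> = (exp 6 * y) ^ s"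
      by (simp add: power_mult_distrib mult.commute flip: exp_of_nat_mult)
    also have "\<dots> \<le> (exp 6 * y) ^ 2"
      using s e6 y by (intro power_decreasing) auto
    also have "\<dots> = exp 12 * \<epsilon>"
      using y(2) by (simp add: power_mult_distrib flip: exp_of_nat_mult)
    finally have "y ^ s \<le> exp 12 * \<epsilon> * exp (- 3 * real k)"
      by (simp add: exp_minus field_simps)
    moreover have "0 \<le> prod_list (map2 \<phi> xs a)"
      unfolding \<open>prod_list (map2 \<phi> xs a) = _\<close> using p0 z by simp
    ultimately show ?thesis unfolding eq by (rule mult_left_mono)
  qed
  have \<phi>0: "0 \<le> \<phi> x j" if "x \<in> set xs" for x j using M[OF that] z by (simp add: \<phi>_def g_def)
  have "(\<Sum>a\<in>comps (length xs) k. if 2 * count_list a 1 < k then prod_list (map2 (^) xs a) else 0)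
     \<le> (\<Sum>a\<in>comps (length xs) k. prod_list (map2 \<phi> xs a) * (exp 12 * \<epsilon> * exp (- 3 * real k)))"
  proof (rule sum_mono)
    fix a assume a: "a \<in> comps (length xs) k"
    have "0 \<le> prod_list (map2 \<phi> xs a)"
      using \<phi>0 by (intro prod_list_nonneg) (auto dest!: set_zip_leftD)
    then show "(if 2 * count_list a 1 < k then prod_list (map2 (^) xs a) else 0)
      \<le> prod_list (map2 \<phi> xs a) * (exp 12 * \<epsilon> * exp (- 3 * real k))"
      using tail[OF a] eps(2) by simp
  qed
  also have "\<dots> = comp_sum \<phi> xs k * (exp 12 * \<epsilon> * exp (- 3 * real k))"
    by (simp add: comp_sum_eq sum_distrib_right)
  finally have 1: "(\<Sum>a\<in>comps (length xs) k. if 2 * count_list a 1 < k then prod_list (map2 (^) xs a) else 0)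
     \<le> comp_sum \<phi> xs k * (exp 12 * \<epsilon> * exp (- 3 * real k))" .
  have 2: "comp_sum \<phi> xs k * t ^ k \<le> exp ((3 * t) * sum_list xs)"
  proof (rule comp_sum_le_exp)
    fix x l assume x: "x \<in> set xs"
    define u where "u = x * t"
    have u: "0 \<le> u" using M[OF x] t by (simp add: u_def)
    have "x * t \<le> M * t" using M[OF x] t by (intro mult_right_mono) auto
    then have u_le: "u \<le> \<epsilon>" by (simp add: u_def eps(1) t_def)
    have zu: "z * u \<le> z * \<epsilon>" "z ^ 2 * u \<le> z ^ 2 * \<epsilon>" using u_le z by (auto intro!: mult_left_mono)
    have "z * \<epsilon> = y" "z ^ 2 * \<epsilon> = 1"
      using y by (simp_all add: z_def power_divide power2_eq_square flip: y(2))
    then have "(\<Sum>j\<le>l. u ^ j * (if 2 \<le> j then z ^ j else 1)) \<le> exp (3 * u)"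
      using zu u z y2 by (intro weighted_powers_le_exp) auto
    then show "(\<Sum>j\<le>l. \<phi> x j * t ^ j) \<le> exp (3 * t * x)"
      by (simp add: \<phi>_def g_def u_def power_mult_distrib mult_ac)
  qed (use t \<phi>0 in auto)
  have tX: "t * X = real k" using X by (simp add: t_def)
  have kX: "real k ^ k = t ^ k * X ^ k" by (simp add: tX flip: power_mult_distrib)
  have cs0: "0 \<le> comp_sum \<phi> xs k"
    unfolding comp_sum_eq using \<phi>0 by (intro sum_nonneg prod_list_nonneg) (auto dest!: set_zip_leftD)
  have "(fact k :: real) \<le> real k ^ k" using fact_le_power[of k] by simp
  then have "fact k * comp_sum \<phi> xs k \<le> real k ^ k * comp_sum \<phi> xs k" using cs0 by (rule mult_right_mono)
  also have "\<dots> = X ^ k * (comp_sum \<phi> xs k * t ^ k)" by (simp add: kX)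
  also have "\<dots> \<le> X ^ k * exp (3 * real k)"
    using 2 X tX by (intro mult_left_mono) (auto simp: mult.assoc)
  finally have 3: "fact k * comp_sum \<phi> xs k \<le> X ^ k * exp (3 * real k)" .
  have "fact k * (\<Sum>a\<in>comps (length xs) k. if 2 * count_list a 1 < k then prod_list (map2 (^) xs a) else 0)
     \<le> fact k * (comp_sum \<phi> xs k * (exp 12 * \<epsilon> * exp (- 3 * real k)))"
    using 1 by (rule mult_left_mono) simp
  also have "\<dots> = (fact k * comp_sum \<phi> xs k) * (exp 12 * \<epsilon> * exp (- 3 * real k))" by simp
  also have "\<dots> \<le> (X ^ k * exp (3 * real k)) * (exp 12 * \<epsilon> * exp (- 3 * real k))"
    using 3 eps(2) by (intro mult_right_mono) auto
  also have "\<dots> = X ^ k * (exp 12 * \<epsilon>)" by (simp add: exp_minus field_simps)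
  finally show ?thesis .
qed

text \<open>If at least half of the letters occur once, the Kostka number is bounded by the damped
  weights; otherwise it is bounded by \<open>std_count p\<close> and the content goes into the tail.
  Both bounds are nonnegative, so the damped sum may run over all contents.\<close>

lemma schur_upper_bound:
  assumes p: "par p" and k: "k = psize p" "k > 0" and R: "R > 0" "real (p 0) \<le> R"
    and M: "\<And>x. x \<in> set xs \<Longrightarrow> 0 \<le> x \<and> x \<le> M" and X: "X = sum_list xs" "X > 0"
    and eps: "\<epsilon> = M * real k / X" "0 < \<epsilon>" "\<epsilon> \<le> exp (-12)"
  shows "fact k * schur xs p \<le> std_count p * (X ^ k * exp ((2 * (R + 1) + exp 12) * \<epsilon>))"
proof -
  \<comment> \<open>Chosen so that \<open>R + 1 = \<rho> * (k / 2)\<close>, where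
    \<open>k / 2\<close> is the guaranteed number of letters that occur once.\<close>
  define \<rho> where "\<rho> = 2 * (R + 1) / real k"
  define w where "w j = rise \<rho> 1 j / fact j" for j
  define \<phi> where "\<phi> x j = x ^ j * w j" for x and j :: nat
  let ?C = "comps (length xs) k"
  let ?K = "\<lambda>a. kostka a (ind (\<lambda>_. 0)) p"
  let ?tail = "\<lambda>a. if 2 * count_list a 1 < k then prod_list (map2 (^) xs a) else 0"
  have M0: "M > 0" using eps k X by (auto simp: zero_less_mult_iff zero_less_divide_iff)
  have \<rho>0: "\<rho> > 0" using R k by (simp add: \<rho>_def)
  have w0: "0 \<le> w j" for j using \<rho>0 by (simp add: w_def rise_nonneg)
  have \<phi>0: "0 \<le> \<phi> x j" if "x \<in> set xs" for x j using M[OF that] w0 by (simp add: \<phi>_def)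
  have bound: "prod_list (map2 (^) xs a) * ?K a \<le> (prod_list (map2 \<phi> xs a) + ?tail a) * std_count p"
    if a: "a \<in> ?C" for a
  proof -
    have len: "length a = length xs" using a by (simp add: comps_def)
    have p0: "0 \<le> prod_list (map2 (^) xs a)" "0 \<le> prod_list (map2 \<phi> xs a)"
      using M \<phi>0 by (auto intro!: prod_list_nonneg dest!: set_zip_leftD)
    show ?thesis
    proof (cases "2 * count_list a 1 < k")
      case True
      have "?K a \<le> std_count p" using kostka_le_std_count[OF p, of a 0] by simp
      then have "prod_list (map2 (^) xs a) * ?K a \<le> prod_list (map2 (^) xs a) * std_count p"
        using p0 by (intro mult_left_mono)
      also have "\<dots> \<le> (prod_list (map2 \<phi> xs a) + ?tail a) * std_count p"
        using p0 True std_count_nonneg by (intro mult_right_mono) auto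
      finally show ?thesis .
    next
      case False
      have "real k \<le> 2 * real (count_list a 1)" using False by linarith
      then have "\<rho> * (real k / 2) \<le> \<rho> * real (count_list a 1)" using \<rho>0 by (intro mult_left_mono) auto
      then have "R + 1 \<le> \<rho> * real (count_list a 1)" using k by (simp add: \<rho>_def)
      then have "?K a \<le> prod_list (map w (filter (\<lambda>j. 2 \<le> j) a)) * std_count p"
        unfolding kostka_filter[OF p, of a] w_def using p R \<rho>0 by (intro kostka_le_ratio) auto
      also have "prod_list (map w (filter (\<lambda>j. 2 \<le> j) a)) = prod_list (map w a)"
        by (rule prod_list_filter_trivial) (simp_all add: w_def rise_def)
      finally have "prod_list (map2 (^) xs a) * ?K a \<le> prod_list (map2 (^) xs a) * (prod_list (map w a) * std_count p)"
        using p0 by (intro mult_left_mono)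
      also have "\<dots> = prod_list (map2 \<phi> xs a) * std_count p"
        unfolding \<phi>_def by (simp add: prod_list_map2_mult[OF len, symmetric])
      finally show ?thesis using False by simp
    qed
  qed
  have "fact k * schur xs p \<le> fact k * (\<Sum>a\<in>?C. (prod_list (map2 \<phi> xs a) + ?tail a) * std_count p)"
    unfolding schur_eq_kostka[OF p] k(1)[symmetric] by (intro mult_left_mono sum_mono bound) auto
  also have "\<dots> = std_count p * (fact k * comp_sum \<phi> xs k + fact k * (\<Sum>a\<in>?C. ?tail a))"
    unfolding comp_sum_eq sum_distrib_right[symmetric] sum.distrib by (simp add: algebra_simps)
  also have "\<dots> \<le> std_count p * (X ^ k * exp (2 * (R + 1) * \<epsilon>) + X ^ k * (exp 12 * \<epsilon>))"
  proof (intro mult_left_mono add_mono std_count_nonneg)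
    have "fact k * comp_sum \<phi> xs k \<le> rise (\<rho> * M) (sum_list xs) k"
    proof (rule comp_sum_le_rise[THEN conjunct2])
      fix x j assume x: "x \<in> set xs"
      show "0 \<le> \<phi> x j \<and> fact j * \<phi> x j \<le> rise (\<rho> * M) x j"
        using \<phi>0[OF x] power_mult_rise_le[of x M \<rho> j] M[OF x] \<rho>0 by (simp add: \<phi>_def w_def)
    qed (use M M0 \<rho>0 in auto)
    also have "\<dots> \<le> X ^ k * exp (real k ^ 2 * (\<rho> * M) / X)"
      using rise_le_exp[of X "\<rho> * M" k] X M0 \<rho>0 by simp
    also have "real k ^ 2 * (\<rho> * M) / X = 2 * (R + 1) * \<epsilon>"
      using k X by (simp add: \<rho>_def eps(1) power2_eq_square field_simps)
    finally show "fact k * comp_sum \<phi> xs k \<le> X ^ k * exp (2 * (R + 1) * \<epsilon>)" .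
    show "fact k * (\<Sum>a\<in>?C. ?tail a) \<le> X ^ k * (exp 12 * \<epsilon>)"
      by (rule repeated_letters_tail[OF k(2) M X eps])
  qed
  also have "\<dots> \<le> std_count p * (X ^ k * exp ((2 * (R + 1) + exp 12) * \<epsilon>))"
  proof (intro mult_left_mono std_count_nonneg)
    have e: "1 \<le> exp (2 * (R + 1) * \<epsilon>)" using R eps(2) by simp
    \<comment> \<open>The tail is merged into the exponent by
      \<open>a + b \<le> a * (1 + b) \<le> a * exp b\<close>, valid since \<open>a \<ge> 1\<close>
      and \<open>b \<ge> 0\<close>.\<close>
    have "exp 12 * \<epsilon> \<le> exp (2 * (R + 1) * \<epsilon>) * (exp 12 * \<epsilon>)"
      using mult_right_mono[OF e, of "exp 12 * \<epsilon>"] eps(2) by simp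
    then have "exp (2 * (R + 1) * \<epsilon>) + exp 12 * \<epsilon> \<le> exp (2 * (R + 1) * \<epsilon>) * (1 + exp 12 * \<epsilon>)"
      by (simp add: distrib_left)
    also have "\<dots> \<le> exp (2 * (R + 1) * \<epsilon>) * exp (exp 12 * \<epsilon>)"
      by (intro mult_left_mono exp_ge_add_one_self) simp
    finally have "exp (2 * (R + 1) * \<epsilon>) + exp 12 * \<epsilon> \<le> exp ((2 * (R + 1) + exp 12) * \<epsilon>)"
      by (simp only: distrib_right exp_add)
    then show "X ^ k * exp (2 * (R + 1) * \<epsilon>) + X ^ k * (exp 12 * \<epsilon>) \<le> X ^ k * exp ((2 * (R + 1) + exp 12) * \<epsilon>)"
      using X unfolding distrib_left[symmetric] by (intro mult_left_mono) auto
  qed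
  finally show ?thesis .
qed

section \<open>Skew tableaux\<close>

lemma skew_diagram_eq: "skew_diagram la mu = cells (rows_fun la) (rows_fun mu)"
  by (auto simp: skew_diagram_def young_diagram_def cells_def rows_fun_def split: if_splits)

lemma young_diagram_eq: "young_diagram la = cells (rows_fun la) (\<lambda>_. 0)"
  by (auto simp: young_diagram_def cells_def rows_fun_def split: if_splits)

lemma f_shape_eq:
  assumes "sorted_wrt (\<ge>) la" shows "real (f_shape la) = std_count (rows_fun la)"
  unfolding f_shape_def young_diagram_eq std_count_def
  using par_rows_fun[OF assms] by (intro card_SYT_cells) auto

lemma part_subseteq_rows_fun:
  assumes "part_subseteq mu la" shows "rows_fun mu i \<le> rows_fun la i"
proof (cases "rows_fun mu i = 0")
  case False
  then have i: "i < length mu" "rows_fun mu i = mu ! i" by (auto simp: rows_fun_def split: if_splits)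
  then have "(i, mu ! i - 1) \<in> young_diagram mu" using False by (auto simp: young_diagram_def)
  then have "(i, mu ! i - 1) \<in> young_diagram la" using assms by (auto simp: part_subseteq_def)
  then show ?thesis using i by (auto simp: young_diagram_def rows_fun_def)
qed simp

lemma power_le_fact_ratio: "real m ^ k * fact m \<le> fact (m + k)"
proof (induction k)
  case (Suc k)
  have "real m ^ Suc k * fact m = real m * (real m ^ k * fact m)" by simp
  also have "\<dots> \<le> real (Suc (m + k)) * fact (m + k)" using Suc by (intro mult_mono) auto
  finally show ?case by simp
qed simp

text \<open>By \<open>okounkov_olshanski\<close> the quantity equals
  \<open>k! * m! / (m + k)!\<close> times the shifted Schur function, divided by
  \<open>std_count (rows_fun mu)\<close>, when the counts are nonzero. The factorial quotient
  \<open>m! / (m + k)!\<close> is at most \<open>1 / m^k\<close>.\<close>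

lemma A_skew_le_schur:
  fixes R :: real
  assumes la: "sorted_wrt (\<ge>) la" "sum_list la = m + k" and mu: "sorted_wrt (\<ge>) mu" "sum_list mu = k"
    and sub: "part_subseteq mu la" and R: "R \<ge> 0" "real (length mu) \<le> R" and m: "m > 0"
    and Bn: "B \<ge> 0"
    and B: "fact k * schur (map (\<lambda>x. real x + R) la) (rows_fun mu) \<le> std_count (rows_fun mu) * B"
  shows "A_skew la mu \<le> B / real m ^ k"
proof -
  let ?p = "rows_fun la" and ?q = "rows_fun mu"
  let ?t = "shifted_schur (map real la) ?q"
  have p: "par ?p" "psize ?p = m + k" and q: "par ?q" "psize ?q = k"
    using la mu by (simp_all add: par_rows_fun psize_rows_fun)
  have f: "real (f_skew la mu) = (down ^^ m) (ind ?q) ?p"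
    unfolding f_skew_def skew_diagram_eq
    using p q part_subseteq_rows_fun[OF sub] by (intro card_SYT_cells) auto
  have oo: "fact m * ?t * std_count ?p = fact (m + k) * real (f_skew la mu)"
    unfolding f using okounkov_olshanski[OF la(1) q(1), of m] p(2) q(2) by (simp add: add.commute)
  have rows: "real i \<le> R" if "?q i \<noteq> 0" for i
    using that R(2) by (auto simp: rows_fun_def split: if_splits)
  have t: "0 \<le> ?t" "?t \<le> schur (map (\<lambda>x. real x + R) la) ?q"
    using shifted_schur_le_schur[OF q(1) la(1) R(1) rows] by auto
  have A: "A_skew la mu = fact k * real (f_skew la mu) / (std_count ?p * std_count ?q)"
    unfolding A_skew_def mu(2) f_shape_eq[OF la(1)] f_shape_eq[OF mu(1)] ..
  have mk: "0 < real m ^ k" using m by simp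
  show ?thesis
  proof (cases "std_count ?p * std_count ?q = 0")
    \<comment> \<open>By the convention on division by zero the quotient is \<open>0\<close>
      here.\<close>
    case True
    then have "A_skew la mu = 0" unfolding A by simp
    moreover have "0 \<le> B / real m ^ k" using Bn by simp
    ultimately show ?thesis by linarith
  next
    case False
    then have pos: "0 < std_count ?p" "0 < std_count ?q"
      using std_count_nonneg[of ?p] std_count_nonneg[of ?q] by (auto simp: less_le)
    have B0: "fact k * ?t \<le> std_count ?q * B"
      using t B by (intro order_trans[OF mult_left_mono B]) auto
    have "real m ^ k * fact m * real (f_skew la mu) \<le> fact (m + k) * real (f_skew la mu)"
      by (intro mult_right_mono power_le_fact_ratio) simp
    also have "\<dots> = fact m * (?t * std_count ?p)" using oo by simp
    finally have "real m ^ k * real (f_skew la mu) \<le> ?t * std_count ?p"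
      by (simp add: mult_ac)
    then have "real m ^ k * (fact k * real (f_skew la mu)) \<le> (fact k * ?t) * std_count ?p"
      using mult_left_mono[of _ _ "fact k :: real"] by (simp add: mult_ac)
    also have "\<dots> \<le> (std_count ?q * B) * std_count ?p" using B0 pos by (intro mult_right_mono) auto
    finally show ?thesis unfolding A using pos mk by (simp add: divide_simps mult_ac)
  qed
qed

theorem theorem1p4:
  fixes L :: real
  assumes "L > 0"
  shows "\<exists>C1 C2 :: real. C1 > 0 \<and> C2 > 0 \<and>
    (\<forall>la mu :: nat list. \<forall>n k :: nat.
       partition_of la n \<longrightarrow> partition_of mu k \<longrightarrow> part_subseteq mu la \<longrightarrow>
       real (num_rows la) < L * sqrt (real n) \<longrightarrow> real (num_cols la) < L * sqrt (real n) \<longrightarrow>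
       real (num_rows mu) < L * sqrt (real k) \<longrightarrow> real (num_cols mu) < L * sqrt (real k) \<longrightarrow>
       real k < C1 * sqrt (real n) \<longrightarrow>
       A_skew la mu \<le> exp (C2 * real k powr (3/2) * real n powr (-1/2)))"
proof -
  \<comment> \<open>The bound \<open>1/2\<close> gives \<open>2 * k \<le> n\<close>, and the second
    entry gives \<open>\<epsilon> \<le> 2 * L * C1 \<le> exp (-12)\<close>.\<close>
  define C1 where "C1 = min (1/2) (exp (-12) / (2 * L))"
  \<comment> \<open>\<open>L\<^sup>2\<close> accounts for the shift of the variables by
    \<open>R\<close>, \<open>2\<close> for replacing \<open>n\<close> by \<open>m = n - k\<close>,
    and the product for the exponent of \<open>schur_upper_bound\<close>, where
    \<open>2 * (R + 1) + exp 12 \<le> (2 * L + 2 + exp 12) * u\<close> and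
    \<open>\<epsilon> \<le> 2 * L * (u^2 / v)\<close>.\<close>
  define C2 where "C2 = L\<^sup>2 + 2 + (2 * L + 2 + exp 12) * (2 * L)"
  have C1: "C1 > 0" "C1 \<le> 1/2" "2 * L * C1 \<le> exp (-12)"
  proof -
    show "C1 > 0" "C1 \<le> 1/2" using assms by (simp_all add: C1_def)
    have "2 * L * C1 \<le> 2 * L * (exp (-12) / (2 * L))" using assms by (intro mult_left_mono) (auto simp: C1_def)
    then show "2 * L * C1 \<le> exp (-12)" using assms by simp
  qed
  have C2: "C2 > 0" unfolding C2_def using assms by (intro add_pos_nonneg add_nonneg_pos mult_nonneg_nonneg) (auto intro: add_nonneg_nonneg)
  have main: "A_skew la mu \<le> exp (C2 * real k powr (3/2) * real n powr (-1/2))"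
    if la: "partition_of la n" and mu: "partition_of mu k" and sub: "part_subseteq mu la"
      and ra: "real (num_rows la) < L * sqrt (real n)" and ca: "real (num_cols la) < L * sqrt (real n)"
      and rm: "real (num_rows mu) < L * sqrt (real k)" and cm: "real (num_cols mu) < L * sqrt (real k)"
      and kn: "real k < C1 * sqrt (real n)"
    for la mu :: "nat list" and n k :: nat
  proof -
    define u where "u = sqrt (real k)"
    define v where "v = sqrt (real n)"
    define R where "R = L * u"
    \<comment> \<open>A shifted variable is a row length plus \<open>R\<close>, and both are at most
      \<open>L * v\<close> because \<open>u \<le> v\<close>.\<close>
    define M where "M = 2 * L * v"
    define xs where "xs = map (\<lambda>x. real x + R) la"
    define X where "X = sum_list xs"
    define m where "m = n - k"
    define \<epsilon> where "\<epsilon> = M * real k / X"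
    \<comment> \<open>For \<open>k = 0\<close> the strict bound on the number of rows of
      \<open>mu\<close> would read \<open>0 < 0\<close>.\<close>
    have k0: "k > 0"
    proof (rule ccontr)
      assume "\<not> ?thesis"
      then show False using rm by simp
    qed
    have u: "u \<ge> 1" "u ^ 2 = real k" using k0 by (simp_all add: u_def)
    have v: "v ^ 2 = real n" "v \<ge> 0" by (simp_all add: v_def)
    have v1: "u ^ 2 \<le> v / 2"
    proof -
      have "C1 * v \<le> 1/2 * v" using C1(2) v(2) by (rule mult_right_mono)
      then show ?thesis using kn u(2) by (simp add: v_def)
    qed
    have u2: "u \<le> u ^ 2" using u(1) by (simp add: power2_eq_square mult_le_cancel_left1)
    have uv: "u \<le> v" "1 \<le> v" using v1 u2 u(1) v(2) by linarith+
    have "v * 1 \<le> v * v" using uv by (intro mult_left_mono) auto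
    then have kn2: "2 * real k \<le> real n" using v1 u(2) v(1) by (simp add: power2_eq_square)
    have n: "n = m + k" "real m = real n - real k" "m > 0" using kn2 k0 by (simp_all add: m_def of_nat_diff)
    have la': "sorted_wrt (\<ge>) la" "sum_list la = n" and mu': "sorted_wrt (\<ge>) mu" "sum_list mu = k"
      using la mu by (simp_all add: partition_of_def is_partition_def)
    have R: "R > 0" using assms u by (simp add: R_def)
    have lam: "real x \<le> L * v" if "x \<in> set la" for x
    proof -
      have "x \<le> num_cols la" using la'(1) that by (cases la) (auto simp: num_cols_def)
      then show ?thesis using ca by (simp add: v_def)
    qed
    have M: "0 \<le> x \<and> x \<le> M" if x: "x \<in> set xs" for x
    proof -
      obtain y where y: "y \<in> set la" "x = real y + R" using x by (auto simp: xs_def)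
      have "L * u \<le> L * v" using uv assms by (intro mult_left_mono) auto
      then show ?thesis using lam[OF y(1)] y(2) R by (simp add: M_def R_def)
    qed
    have "X = real (sum_list la) + real (length la) * R"
      unfolding X_def xs_def by (induction la) (simp_all add: algebra_simps)
    then have X: "X = v ^ 2 + real (length la) * R" using la' v by simp
    \<comment> \<open>The shift changes the sum of the variables by a relative amount of at most
      \<open>L^2 * (u / v)\<close>; raised to the power \<open>k = u^2\<close> this costs
      \<open>exp (L^2 * u^3 / v)\<close>.\<close>
    have "real (length la) * R \<le> (L * v) * R"
      using ra R by (intro mult_right_mono) (auto simp: num_rows_def v_def)
    moreover have "(L * v) * R = v ^ 2 * (L ^ 2 * (u / v))"
      using uv(2) by (simp add: R_def power2_eq_square)
    ultimately have Xle: "X \<le> v ^ 2 * (1 + L ^ 2 * (u / v))"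
      unfolding X distrib_left by simp
    have Xge: "v ^ 2 \<le> X" using X R by simp
    have v20: "0 < v ^ 2" using uv by simp
    then have X0: "0 < X" using Xge by linarith
    have M0: "0 < M" using assms uv by (simp add: M_def)
    have eps0: "0 < \<epsilon>" using M0 k0 X0 by (simp add: \<epsilon>_def)
    have "\<epsilon> \<le> M * real k / v ^ 2"
      unfolding \<epsilon>_def using Xge v20 X0 M0 by (intro divide_left_mono mult_pos_pos) auto
    also have "\<dots> = 2 * L * (u ^ 2 / v)" using uv by (simp add: M_def power2_eq_square flip: u(2))
    finally have eps1: "\<epsilon> \<le> 2 * L * (u ^ 2 / v)" .
    have "u ^ 2 / v \<le> C1" using kn uv unfolding u(2) by (simp add: v_def divide_le_eq)
    then have "2 * L * (u ^ 2 / v) \<le> 2 * L * C1" using assms by (intro mult_left_mono) auto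
    then have eps12: "\<epsilon> \<le> exp (-12)" using eps1 C1(3) by linarith
    have cols: "real (rows_fun mu 0) \<le> R"
      using cm by (auto simp: rows_fun_def num_cols_def R_def u_def hd_conv_nth split: if_splits)
    have B: "fact k * schur xs (rows_fun mu) \<le>
        std_count (rows_fun mu) * (X ^ k * exp ((2 * (R + 1) + exp 12) * \<epsilon>))"
      by (rule schur_upper_bound[OF par_rows_fun[OF mu'(1)] _ k0 R cols M X_def X0 \<epsilon>_def eps0 eps12])
        (simp_all add: psize_rows_fun mu')
    have "A_skew la mu \<le> (X ^ k * exp ((2 * (R + 1) + exp 12) * \<epsilon>)) / real m ^ k"
      using la' mu' sub R rm n B X0 unfolding xs_def
      by (intro A_skew_le_schur[where R = R]) (auto simp: num_rows_def R_def u_def)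
    also have "\<dots> = (X / real m) ^ k * exp ((2 * (R + 1) + exp 12) * \<epsilon>)"
      by (simp add: power_divide)
    also have "\<dots> \<le> exp ((L ^ 2 + 2) * (u ^ 3 / v)) * exp ((2 * L + 2 + exp 12) * (2 * L) * (u ^ 3 / v))"
    proof (intro mult_mono)
      have "real n / real m \<le> 1 + 2 * (real k / real n)"
      proof -
        have "real n * real n \<le> (real n + 2 * real k) * real m"
          using mult_right_mono[OF kn2, of "real k"] unfolding n(2) by (simp add: algebra_simps)
        then show ?thesis using n(3) kn2 k0 by (simp add: divide_simps)
      qed
      also have "\<dots> \<le> exp (2 * (real k / real n))" by (rule exp_ge_add_one_self)
      finally have 1: "real n / real m \<le> exp (2 * (u ^ 2 / v ^ 2))" using u v by simp
      have "X / real n \<le> 1 + L ^ 2 * (u / v)"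
        using Xle v20 unfolding v(1)[symmetric] by (simp add: divide_le_eq mult.commute)
      also have "\<dots> \<le> exp (L ^ 2 * (u / v))" by (rule exp_ge_add_one_self)
      finally have 2: "X / real n \<le> exp (L ^ 2 * (u / v))" .
      have "X / real m = (X / real n) * (real n / real m)" using kn2 k0 by simp
      also have "\<dots> \<le> exp (L ^ 2 * (u / v)) * exp (2 * (u ^ 2 / v ^ 2))"
        using 1 2 X0 by (intro mult_mono) auto
      finally have "(X / real m) ^ k \<le> (exp (L ^ 2 * (u / v) + 2 * (u ^ 2 / v ^ 2))) ^ k"
        using X0 by (intro power_mono) (auto simp: exp_add)
      also have "\<dots> = exp (u ^ 2 * (L ^ 2 * (u / v) + 2 * (u ^ 2 / v ^ 2)))"
        by (simp add: u(2) flip: exp_of_nat_mult)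
      also have "\<dots> \<le> exp ((L ^ 2 + 2) * (u ^ 3 / v))"
      proof -
        have "u ^ 2 * (L ^ 2 * (u / v)) = L ^ 2 * (u ^ 3 / v)"
          by (simp add: power2_eq_square power3_eq_cube)
        moreover have "u ^ 2 * (2 * (u ^ 2 / v ^ 2)) = 2 * (u ^ 3 / v) * (u / v)"
          by (simp add: power2_eq_square power3_eq_cube)
        \<comment> \<open>Passing from \<open>n\<close> to \<open>m\<close> costs only
          \<open>2 * u^4 / v^2\<close>, which is of lower order because
          \<open>u \<le> v\<close>.\<close>
        moreover have "2 * (u ^ 3 / v) * (u / v) \<le> 2 * (u ^ 3 / v) * 1"
          using uv u by (intro mult_left_mono) auto
        ultimately have "u ^ 2 * (L ^ 2 * (u / v) + 2 * (u ^ 2 / v ^ 2)) \<le> (L ^ 2 + 2) * (u ^ 3 / v)"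
          unfolding distrib_left distrib_right by linarith
        then show ?thesis by simp
      qed
      finally show "(X / real m) ^ k \<le> exp ((L ^ 2 + 2) * (u ^ 3 / v))" .
      \<comment> \<open>Since \<open>u \<ge> 1\<close>, the constant part, including the tail, is
        absorbed into a multiple of \<open>u\<close>; multiplied by \<open>\<epsilon>\<close> of
        order \<open>u^2 / v\<close> it gives \<open>u^3 / v\<close>.\<close>
      have "2 * (R + 1) + exp 12 \<le> (2 * L + 2 + exp 12) * u"
      proof -
        have "(2 + exp 12) * 1 \<le> (2 + exp 12) * u" using u by (intro mult_left_mono) (auto intro: add_nonneg_nonneg)
        then show ?thesis by (simp add: R_def algebra_simps)
      qed
      then have "(2 * (R + 1) + exp 12) * \<epsilon> \<le> ((2 * L + 2 + exp 12) * u) * (2 * L * (u ^ 2 / v))"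
        using eps1 eps0 assms u by (intro mult_mono) (auto intro!: mult_nonneg_nonneg add_nonneg_nonneg)
      also have "\<dots> = (2 * L + 2 + exp 12) * (2 * L) * (u ^ 3 / v)"
        by (simp add: power2_eq_square power3_eq_cube)
      finally show "exp ((2 * (R + 1) + exp 12) * \<epsilon>) \<le> exp ((2 * L + 2 + exp 12) * (2 * L) * (u ^ 3 / v))" by simp
    qed simp_all
    also have "\<dots> = exp (C2 * (u ^ 3 / v))"
      unfolding C2_def distrib_right[of _ _ "u ^ 3 / v"] exp_add ..
    also have "u ^ 3 / v = real k powr (3/2) * real n powr (-1/2)"
    proof -
      have "u ^ 3 = real k powr (3/2)" using k0
        by (simp add: u_def powr_half_sqrt[symmetric] powr_powr flip: powr_realpow)
      moreover have "1 / v = real n powr (-1/2)"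
        by (simp add: v_def powr_minus_divide powr_half_sqrt)
      ultimately show ?thesis by (metis times_divide_eq_right mult.right_neutral)
    qed
    finally show ?thesis by (simp add: mult.assoc)
  qed
  show ?thesis
    by (rule exI[of _ C1], rule exI[of _ C2]) (use C1(1) C2 main in blast)
qed

end
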